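(* Let $g$ be a positive integer and let $G=(V,E)$ be a finite connected $g$-regular graph with $K=|V|$ vertices. For each $\lambda>0$, $\beta>0$, and for each $K>K^*=(g+1)/\lambda$, the Markov process $\mathcal{M}_G$ (with total exogenous arrival rate $\lambda$ per node, service rate $1$ and swap rate $\beta$) is transient.
   Context: A graph is $g$-regular if every vertex has $g$ edges adjacent to it. $\mathrm{dist}$ is graph distance on $G$. At each node of $G$ there is one server with a FIFO queue, described by the finite word of destinations (elements of $V$) of its customers, listed in order of arrival. $\mathcal{M}_G$ is the continuous-time Markov process on the countable set of queue configurations with the following dynamics. (Arrivals) Exogenous customers arrive at each node according to independent Poisson processes of rate $\lambda$ and join the end of the queue of the server there; upon arrival at node $v$, a customer $c$ is assigned a random destination $D(c)\in V$ with a law that may depend on $v$. (Services) Each node has an independent Poisson clock of rate $1$. When the clock at $v$ rings and the queue at $v$ is nonempty, its first customer $c$ completes its service. If $\mathrm{dist}(v,D(c))\le1$ it leaves the network; otherwise it joins the end of the queue at a node chosen uniformly among the neighbors $w$ of $v$ with $\mathrm{dist}(w,D(c))=\mathrm{dist}(v,D(c))-1$. (Swaps) Each edge has an independent Poisson clock of rate $\beta$; when it rings, the two servers at its endpoints exchange positions together with their whole queues. Transience is in the usual sense for continuous-time Markov chains on a countable state space. *)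

theory Defs
  imports "HOL-Probability.Probability"
begin

section \<open>Finite simple graphs\<close>

text \<open>The vertex set is a finite type; a graph is given by its set of undirected edges.\<close>

definition simple_graph :: "'v set set \<Rightarrow> bool" where
  "simple_graph E \<longleftrightarrow> (\<forall>e\<in>E. card e = 2)"

definition adjacency :: "'v set set \<Rightarrow> 'v rel" where
  "adjacency E = {(u, v). {u, v} \<in> E}"

definition regular_graph :: "nat \<Rightarrow> 'v set set \<Rightarrow> bool" where
  "regular_graph g E \<longleftrightarrow> (\<forall>v. card {e \<in> E. v \<in> e} = g)"

definition connected_graph :: "'v set set \<Rightarrow> bool" where
  "connected_graph E \<longleftrightarrow> (\<forall>u v. (u, v) \<in> (adjacency E)\<^sup>*)"

text \<open>Length of a shortest walk; only meaningful when the two vertices are connected.\<close>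

definition graph_dist :: "'v set set \<Rightarrow> 'v \<Rightarrow> 'v \<Rightarrow> nat" where
  "graph_dist E u v = (LEAST n. (u, v) \<in> adjacency E ^^ n)"


section \<open>Continuous-time Markov chains on a countable state space\<close>

text \<open>
  A chain is specified by its off-diagonal transition rates \<open>q x y\<close>, \<open>x \<noteq> y\<close>;
  the diagonal values \<open>q x x\<close> are never used. The rates are meant to be nonnegative and
  summable over \<open>y\<close> (an infinite sum that does not converge would be 0).
\<close>

definition exit_rate :: "('s \<Rightarrow> 's \<Rightarrow> real) \<Rightarrow> 's \<Rightarrow> real" where
  "exit_rate q x = (\<Sum>\<^sub>\<infinity>y\<in>-{x}. q x y)"

definition jump_prob :: "('s \<Rightarrow> 's \<Rightarrow> real) \<Rightarrow> 's \<Rightarrow> 's \<Rightarrow> real" where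
  "jump_prob q x y =
     (if exit_rate q x = 0 then of_bool (y = x)
      else if y = x then 0
      else q x y / exit_rate q x)"

definition jump_time :: "(nat \<Rightarrow> 'w \<Rightarrow> ennreal) \<Rightarrow> nat \<Rightarrow> 'w \<Rightarrow> ennreal" where
  "jump_time S n \<omega> = (\<Sum>k<n. S k \<omega>)"

text \<open>
  \<open>ctmc_from M q x X\<close>: on the probability space \<open>M\<close>, the right-continuous process
  \<open>(X t)\<close>, \<open>t \<ge> 0\<close>, is the (minimal) Markov chain with rates \<open>q\<close> started at \<open>x\<close>.
  Its jump chain \<open>Y\<close> is the discrete-time chain with transition matrix
  \<open>jump_prob q\<close> started at \<open>x\<close> and, conditionally on \<open>Y\<close>, its holding
  times \<open>S k\<close> are independent and exponential with parameter
  \<open>exit_rate q (Y k)\<close> (a holding time is infinite when this parameter is 0).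
  The value \<open>None\<close> is the cemetery state occupied after an explosion; it plays no role
  when the exit rates are bounded.
\<close>

definition ctmc_from ::
  "'w measure \<Rightarrow> ('s \<Rightarrow> 's \<Rightarrow> real) \<Rightarrow> 's \<Rightarrow> (real \<Rightarrow> 'w \<Rightarrow> 's option) \<Rightarrow> bool" where
  "ctmc_from M q x X \<longleftrightarrow>
     prob_space M \<and>
     (\<exists>Y S.
        (\<forall>n. Y n \<in> measurable M (count_space UNIV)) \<and>
        (\<forall>n. S n \<in> borel_measurable M) \<and>
        (\<forall>n (y :: nat \<Rightarrow> 's) (s :: nat \<Rightarrow> real). (\<forall>k. 0 \<le> s k) \<longrightarrow>
           measure M {\<omega> \<in> space M. (\<forall>k\<le>n. Y k \<omega> = y k) \<and> (\<forall>k<n. ennreal (s k) < S k \<omega>)} =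
           of_bool (y 0 = x) *
           (\<Prod>k<n. jump_prob q (y k) (y (Suc k)) * exp (- exit_rate q (y k) * s k))) \<and>
        (\<forall>\<omega>\<in>space M. \<forall>t\<ge>0.
           (\<forall>n. jump_time S n \<omega> \<le> ennreal t \<and> ennreal t < jump_time S (Suc n) \<omega>
                  \<longrightarrow> X t \<omega> = Some (Y n \<omega>)) \<and>
           ((\<forall>n. jump_time S n \<omega> \<le> ennreal t) \<longrightarrow> X t \<omega> = None)))"

text \<open>
  A chain is transient if every state \<open>x\<close> is: started at \<open>x\<close>, the chain almost
  surely visits \<open>x\<close> only at a bounded set of times. The first argument merely names
  the type of sample points, over which statements about the chain are to be polymorphic.
\<close>

definition transient_ctmc :: "'w itself \<Rightarrow> ('s \<Rightarrow> 's \<Rightarrow> real) \<Rightarrow> bool" where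
  "transient_ctmc _ q \<longleftrightarrow>
     (\<forall>(M :: 'w measure) x X. ctmc_from M q x X \<longrightarrow>
        (AE \<omega> in M. bdd_above {t. 0 \<le> t \<and> X t \<omega> = Some x}))"


section \<open>The queueing network with mobile servers\<close>

text \<open>
  A configuration assigns to each node the queue of the server currently located there,
  as the list of the customers' destinations with the first customer at the head.
  Each of the following gives the law of the configuration after one ring of a clock.
\<close>

type_synonym 'v config = "'v \<Rightarrow> 'v list"

definition arrival_step :: "('v \<Rightarrow> 'v pmf) \<Rightarrow> 'v \<Rightarrow> 'v config \<Rightarrow> 'v config pmf" where
  "arrival_step D v x = map_pmf (\<lambda>d. x(v := x v @ [d])) (D v)"

definition service_step :: "'v set set \<Rightarrow> 'v \<Rightarrow> 'v config \<Rightarrow> 'v config pmf" where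
  "service_step E v x =
     (case x v of
        [] \<Rightarrow> return_pmf x
      | d # ds \<Rightarrow>
          (if graph_dist E v d \<le> 1 then return_pmf (x(v := ds))
           else map_pmf (\<lambda>w. x(v := ds, w := x w @ [d]))
                  (pmf_of_set {w. {v, w} \<in> E \<and> graph_dist E w d = graph_dist E v d - 1})))"

definition swap_step :: "'v set \<Rightarrow> 'v config \<Rightarrow> 'v config pmf" where
  "swap_step e x = return_pmf (\<lambda>v. if v \<in> e then x (the_elem (e - {v})) else x v)"

text \<open>
  By superposition of the independent Poisson clocks, the rate of going from \<open>x\<close> to
  \<open>y \<noteq> x\<close> is the sum over all clocks of the rate of the clock times the probability that
  its ring leads from \<open>x\<close> to \<open>y\<close>.
\<close>

definition network_rate ::
  "('v::finite) set set \<Rightarrow> real \<Rightarrow> real \<Rightarrow> ('v \<Rightarrow> 'v pmf) \<Rightarrow> 'v config \<Rightarrow> 'v config \<Rightarrow> real" where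
  "network_rate E lam bet D x y =
     (\<Sum>v\<in>UNIV. lam * pmf (arrival_step D v x) y) +
     (\<Sum>v\<in>UNIV. pmf (service_step E v x) y) +
     (\<Sum>e\<in>E. bet * pmf (swap_step e x) y)"

end

theory Submission
  imports Defs "HOL-Real_Asymp.Real_Asymp" "HOL-Combinatorics.Transposition"
begin

text \<open>
  The number of customers in the queue of a server grows at rate \<open>\<lambda>\<close>, shrinks at rate
  \<open>1\<close>, and also grows by the customers routed to it from the other servers. When all queues
  are long, a customer is served only after its server has been moved around for a long time, so that
  the pair (receiving server, serving server) is then nearly uniform on the pairs of distinct nodes,
  because the edge swaps act transitively on those. A customer is routed onwards from
  all but at most \<open>g + 1\<close> nodes, hence every server receives customers at rate about
  \<open>1 - (g + 1) / K\<close>, and its queue has drift about \<open>\<lambda> - (g + 1) / K > 0\<close>.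

  To make this a Lyapunov argument, the queue length is corrected by a function \<open>\<psi>\<^sub>k\<close> of
  the positions of the two servers for each of the first \<open>N\<close> customers of every other queue,
  where \<open>\<psi>\<^sub>0\<close> is the routing probability, \<open>(1 - L) \<psi>\<^sub>k\<^sub>+\<^sub>1 = \<psi>\<^sub>k\<close> and
  \<open>L\<close> is the generator of the swaps. The drift of the corrected length \<open>W\<^sub>w\<close> telescopes,
  leaving only \<open>\<psi>\<^sub>N\<close>, which is close to the mean of \<open>\<psi>\<^sub>0\<close>. For small
  \<open>\<theta>\<close> the function \<open>f = \<Sum>\<^sub>w exp (- \<theta> W\<^sub>w)\<close> then has negative drift where all
  queues are long. As \<open>f\<close> is small only there, \<open>min f c\<close> is a bounded nonnegative
  superharmonic function for small \<open>c\<close>, strictly so on \<open>{f < c}\<close>, a set that arrivals reach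
  from every state; hence every state is visited finitely often.
\<close>

section \<open>Superharmonic functions and transience\<close>

text \<open>
  \<open>path_weight q x s n z\<close> is the probability that the jump chain started at \<open>x\<close> is at
  \<open>z\<close> after \<open>n\<close> jumps and the holding times satisfy \<open>S k > s k\<close> for \<open>k < n\<close>.
\<close>

fun path_weight :: "('s \<Rightarrow> 's \<Rightarrow> real) \<Rightarrow> 's \<Rightarrow> (nat \<Rightarrow> real) \<Rightarrow> nat \<Rightarrow> 's \<Rightarrow> ennreal" where
  "path_weight q x s 0 z = of_bool (z = x)"
| "path_weight q x s (Suc n) z =
     (\<integral>\<^sup>+y. path_weight q x s n y * ennreal (jump_prob q y z * exp (- exit_rate q y * s n)) \<partial>count_space UNIV)"

lemma jump_prob_nonneg:
  assumes "\<And>x y. 0 \<le> q x y"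
  shows "0 \<le> jump_prob q x y"
proof -
  have "0 \<le> exit_rate q x"
    unfolding exit_rate_def by (intro infsum_nonneg assms)
  then show ?thesis by (simp add: jump_prob_def assms)
qed

text \<open>The coordinates before \<open>n\<close> are summed out one at a time.\<close>

lemma emeasure_path_suffix:
  fixes q :: "('s :: countable) \<Rightarrow> 's \<Rightarrow> real" and Y :: "nat \<Rightarrow> 'w \<Rightarrow> 's"
  assumes "prob_space M" and q: "\<And>x y. 0 \<le> q x y"
    and Y: "\<And>n. Y n \<in> measurable M (count_space UNIV)"
    and S: "\<And>n. S n \<in> borel_measurable M"
    and s: "\<And>k. 0 \<le> s k"
    and fdd: "\<And>n (y :: nat \<Rightarrow> 's) (s :: nat \<Rightarrow> real). (\<forall>k. 0 \<le> s k) \<Longrightarrow>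
           measure M {\<omega> \<in> space M. (\<forall>k\<le>n. Y k \<omega> = y k) \<and> (\<forall>k<n. ennreal (s k) < S k \<omega>)} =
           of_bool (y 0 = x) *
           (\<Prod>k<n. jump_prob q (y k) (y (Suc k)) * exp (- exit_rate q (y k) * s k))"
    and "n \<le> m"
  shows "emeasure M {\<omega> \<in> space M. (\<forall>k\<in>{n..m}. Y k \<omega> = y k) \<and> (\<forall>k<m. ennreal (s k) < S k \<omega>)} =
    path_weight q x s n (y n) *
    (\<Prod>k=n..<m. ennreal (jump_prob q (y k) (y (Suc k)) * exp (- exit_rate q (y k) * s k)))"
  using \<open>n \<le> m\<close>
proof (induction n arbitrary: y)
  case 0
  interpret prob_space M by fact
  have nn: "0 \<le> jump_prob q (y k) (y (Suc k)) * exp (- exit_rate q (y k) * s k)" for k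
    by (simp add: jump_prob_nonneg q)
  have "emeasure M {\<omega> \<in> space M. (\<forall>k\<in>{0..m}. Y k \<omega> = y k) \<and> (\<forall>k<m. ennreal (s k) < S k \<omega>)}
     = ennreal (measure M {\<omega> \<in> space M. (\<forall>k\<le>m. Y k \<omega> = y k) \<and> (\<forall>k<m. ennreal (s k) < S k \<omega>)})"
    by (simp add: emeasure_eq_measure Ball_def)
  also have "\<dots> = ennreal (of_bool (y 0 = x)) *
      (\<Prod>k=0..<m. ennreal (jump_prob q (y k) (y (Suc k)) * exp (- exit_rate q (y k) * s k)))"
    using s nn
    by (subst fdd) (auto simp: ennreal_mult prod_nonneg prod_ennreal atLeast0LessThan)
  finally show ?case by (simp add: of_bool_def)
next
  case (Suc n)
  \<comment> \<open>The event is the disjoint union of the \<open>B w\<close>, which fix the missing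
    value \<open>Y n = w\<close>. The induction hypothesis is used at
    \<open>y(n := w)\<close>.\<close>
  define B where "B w = {\<omega> \<in> space M. (\<forall>k\<in>{n..m}. Y k \<omega> = (y(n := w)) k) \<and> (\<forall>k<m. ennreal (s k) < S k \<omega>)}" for w
  define c where "c = (\<Prod>k=Suc n..<m. ennreal (jump_prob q (y k) (y (Suc k)) * exp (- exit_rate q (y k) * s k)))"
  have ms: "B w \<in> sets M" for w
    unfolding B_def using Y S by measurable
  have B: "emeasure M (B w) = path_weight q x s n w *
      ennreal (jump_prob q w (y (Suc n)) * exp (- exit_rate q w * s n)) * c" for w
  proof -
    have "(\<Prod>k=n..<m. ennreal (jump_prob q ((y(n := w)) k) ((y(n := w)) (Suc k)) * exp (- exit_rate q ((y(n := w)) k) * s k)))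
      = ennreal (jump_prob q w (y (Suc n)) * exp (- exit_rate q w * s n)) * c"
      unfolding c_def using Suc.prems by (subst prod.atLeast_Suc_lessThan) (auto intro!: prod.cong)
    then show ?thesis
      unfolding B_def using Suc by (simp add: mult.assoc)
  qed
  have Bu: "{\<omega> \<in> space M. (\<forall>k\<in>{Suc n..m}. Y k \<omega> = y k) \<and> (\<forall>k<m. ennreal (s k) < S k \<omega>)} = (\<Union>w. B w)"
    using Suc.prems by (auto simp: B_def)
  have "disjoint_family B"
    using Suc.prems by (force simp: disjoint_family_on_def B_def)
  then have "emeasure M (\<Union>w. B w) = (\<integral>\<^sup>+w. emeasure M (B w) \<partial>count_space UNIV)"
    by (intro emeasure_UN_countable) (auto simp: ms)
  also have "\<dots> = path_weight q x s (Suc n) (y (Suc n)) * c"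
    by (simp add: B nn_integral_multc)
  finally show ?case unfolding c_def Bu .
qed

text \<open>The case \<open>m = n\<close> of the suffix formula, whose product is then empty; the
  second identity sums the first over the values of \<open>Y n\<close>.\<close>

lemma emeasure_jump_chain:
  fixes q :: "('s :: countable) \<Rightarrow> 's \<Rightarrow> real" and Y :: "nat \<Rightarrow> 'w \<Rightarrow> 's"
  assumes "prob_space M" and q: "\<And>x y. 0 \<le> q x y"
    and Y: "\<And>n. Y n \<in> measurable M (count_space UNIV)"
    and S: "\<And>n. S n \<in> borel_measurable M"
    and s: "\<And>k. 0 \<le> s k"
    and fdd: "\<And>n (y :: nat \<Rightarrow> 's) (s :: nat \<Rightarrow> real). (\<forall>k. 0 \<le> s k) \<Longrightarrow>
           measure M {\<omega> \<in> space M. (\<forall>k\<le>n. Y k \<omega> = y k) \<and> (\<forall>k<n. ennreal (s k) < S k \<omega>)} =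
           of_bool (y 0 = x) *
           (\<Prod>k<n. jump_prob q (y k) (y (Suc k)) * exp (- exit_rate q (y k) * s k))"
  shows "emeasure M {\<omega> \<in> space M. Y n \<omega> = z \<and> (\<forall>k<n. ennreal (s k) < S k \<omega>)} = path_weight q x s n z"
    and "emeasure M {\<omega> \<in> space M. \<forall>k<n. ennreal (s k) < S k \<omega>} =
      (\<integral>\<^sup>+z. path_weight q x s n z \<partial>count_space UNIV)"
proof -
  show 1: "emeasure M {\<omega> \<in> space M. Y n \<omega> = z \<and> (\<forall>k<n. ennreal (s k) < S k \<omega>)} = path_weight q x s n z" for z
    using emeasure_path_suffix[where q = q, OF assms, of n n "\<lambda>_. z"] by simp
  define B where "B z = {\<omega> \<in> space M. Y n \<omega> = z \<and> (\<forall>k<n. ennreal (s k) < S k \<omega>)}" for z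
  have ms: "B w \<in> sets M" for w
    unfolding B_def using Y S by measurable
  have "{\<omega> \<in> space M. \<forall>k<n. ennreal (s k) < S k \<omega>} = (\<Union>z. B z)"
    by (auto simp: B_def)
  also have "emeasure M \<dots> = (\<integral>\<^sup>+w. emeasure M (B w) \<partial>count_space UNIV)"
    by (intro emeasure_UN_countable) (use ms in \<open>auto simp: disjoint_family_on_def B_def\<close>)
  finally show "emeasure M {\<omega> \<in> space M. \<forall>k<n. ennreal (s k) < S k \<omega>} =
      (\<integral>\<^sup>+z. path_weight q x s n z \<partial>count_space UNIV)"
    by (simp add: B_def 1)
qed

text \<open>Conditioning on the last jump: Tonelli moves the sum over the final state inside, where
  the jump kernel acts on \<open>h\<close>.\<close>

lemma nn_integral_path_weight_Suc:
  fixes q :: "('s :: countable) \<Rightarrow> 's \<Rightarrow> real" and h :: "'s \<Rightarrow> ennreal"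
  assumes q: "\<And>x y. 0 \<le> q x y"
  shows "(\<integral>\<^sup>+z. path_weight q x s (Suc n) z * h z \<partial>count_space UNIV) =
    (\<integral>\<^sup>+y. path_weight q x s n y * ennreal (exp (- exit_rate q y * s n)) *
       (\<integral>\<^sup>+z. ennreal (jump_prob q y z) * h z \<partial>count_space UNIV) \<partial>count_space UNIV)"
proof -
  have "(\<integral>\<^sup>+z. path_weight q x s (Suc n) z * h z \<partial>count_space UNIV) =
    (\<integral>\<^sup>+z. \<integral>\<^sup>+y. path_weight q x s n y * ennreal (exp (- exit_rate q y * s n)) *
       (ennreal (jump_prob q y z) * h z) \<partial>count_space UNIV \<partial>count_space UNIV)"
    unfolding path_weight.simps
    by (intro nn_integral_cong, subst nn_integral_multc[symmetric])
      (auto simp: ennreal_mult jump_prob_nonneg q ac_simps)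
  also have "\<dots> = (\<integral>\<^sup>+y. \<integral>\<^sup>+z. path_weight q x s n y * ennreal (exp (- exit_rate q y * s n)) *
       (ennreal (jump_prob q y z) * h z) \<partial>count_space UNIV \<partial>count_space UNIV)"
    by (rule nn_integral_count_space_nn_integral) auto
  also have "\<dots> = (\<integral>\<^sup>+y. path_weight q x s n y * ennreal (exp (- exit_rate q y * s n)) *
       (\<integral>\<^sup>+z. ennreal (jump_prob q y z) * h z \<partial>count_space UNIV) \<partial>count_space UNIV)"
    by (simp add: nn_integral_cmult)
  finally show ?thesis .
qed

lemma nn_integral_path_weight_zero:
  fixes q :: "('s :: countable) \<Rightarrow> 's \<Rightarrow> real"
  assumes q: "\<And>x y. 0 \<le> q x y"
    and stoch: "\<And>x. (\<integral>\<^sup>+z. ennreal (jump_prob q x z) \<partial>count_space UNIV) = 1"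
  shows "(\<integral>\<^sup>+z. path_weight q x (\<lambda>_. 0) n z \<partial>count_space UNIV) = 1"
proof (induction n)
  case 0
  have "(\<integral>\<^sup>+z. path_weight q x (\<lambda>_. 0) 0 z \<partial>count_space UNIV) = (\<Sum>z\<in>{x}. of_bool (z = x))"
    by (subst nn_integral_count_space'[where A = "{x}"]) auto
  then show ?case by simp
next
  case (Suc n)
  then show ?case
    using nn_integral_path_weight_Suc[where q = q, OF q, where x = x and s = "\<lambda>_. 0" and n = n and h = "\<lambda>_. 1"] by (simp add: stoch)
qed

lemma path_weight_cong:
  "(\<And>k. k < n \<Longrightarrow> s k = t k) \<Longrightarrow> path_weight q x s n z = path_weight q x t n z"
  by (induction n arbitrary: z) auto

text \<open>A Green function bound. Superharmonicity makes the expected total of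
  \<open>\<delta>\<close> along the jump chain at most \<open>h x\<close>, so a state with positive
  \<open>\<delta>\<close> has finitely many expected visits. Finiteness passes back along a possible
  jump, since each visit to \<open>z\<close> is followed by one to \<open>w\<close> with a fixed
  positive probability.\<close>

lemma sum_path_weight_less_top:
  fixes q :: "('s :: countable) \<Rightarrow> 's \<Rightarrow> real" and h \<delta> :: "'s \<Rightarrow> ennreal"
  assumes q: "\<And>x y. 0 \<le> q x y"
    and h: "h x < \<infinity>"
    and super: "\<And>x. (\<integral>\<^sup>+z. ennreal (jump_prob q x z) * h z \<partial>count_space UNIV) + \<delta> x \<le> h x"
    and y: "0 < \<delta> y" "(z, y) \<in> {(z, y). 0 < jump_prob q z y}\<^sup>*"
  shows "(\<Sum>n. path_weight q x (\<lambda>_. 0) n z) < \<infinity>"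
  using y(2)
proof (induction z rule: converse_rtrancl_induct)
  case base
  let ?a = "path_weight q x (\<lambda>_. 0)"
  \<comment> \<open>What \<open>h\<close> loses in expectation over the first \<open>N\<close> jumps
    pays for the accumulated \<open>\<delta>\<close>.\<close>
  have "(\<integral>\<^sup>+z. ?a N z * h z \<partial>count_space UNIV) +
      (\<Sum>n<N. \<integral>\<^sup>+z. ?a n z * \<delta> z \<partial>count_space UNIV) \<le> h x" for N
  proof (induction N)
    case 0
    have "(\<integral>\<^sup>+z. ?a 0 z * h z \<partial>count_space UNIV) = (\<Sum>z\<in>{x}. ?a 0 z * h z)"
      by (subst nn_integral_count_space'[where A = "{x}"]) auto
    then show ?case by simp
  next
    case (Suc N)
    have "(\<integral>\<^sup>+z. ?a (Suc N) z * h z \<partial>count_space UNIV) + (\<integral>\<^sup>+z. ?a N z * \<delta> z \<partial>count_space UNIV)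
      = (\<integral>\<^sup>+y. ?a N y * ((\<integral>\<^sup>+z. ennreal (jump_prob q y z) * h z \<partial>count_space UNIV) + \<delta> y) \<partial>count_space UNIV)"
      by (subst nn_integral_path_weight_Suc[where q = q, OF q]) (simp add: nn_integral_add[symmetric] distrib_left)
    also have "\<dots> \<le> (\<integral>\<^sup>+y. ?a N y * h y \<partial>count_space UNIV)"
      by (intro nn_integral_mono mult_left_mono super) auto
    finally have "(\<integral>\<^sup>+z. ?a (Suc N) z * h z \<partial>count_space UNIV) + (\<integral>\<^sup>+z. ?a N z * \<delta> z \<partial>count_space UNIV)
      \<le> (\<integral>\<^sup>+y. ?a N y * h y \<partial>count_space UNIV)" .
    from order_trans[OF add_right_mono[OF this] Suc] show ?case
      by (simp only: sum.lessThan_Suc ac_simps)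
  qed
  then have le: "(\<Sum>n<N. \<integral>\<^sup>+z. ?a n z * \<delta> z \<partial>count_space UNIV) \<le> h x" for N
    by (rule order_trans[OF add_increasing[OF zero_le order_refl]])
  have "(\<Sum>n<N. ?a n y) * \<delta> y \<le> h x" for N
  proof -
    have "?a n y * \<delta> y \<le> (\<integral>\<^sup>+z. ?a n z * \<delta> z \<partial>count_space UNIV)" for n
    proof -
      have "?a n y * \<delta> y = (\<integral>\<^sup>+z. ?a n z * \<delta> z * indicator {y} z \<partial>count_space UNIV)"
        by (subst nn_integral_count_space'[where A = "{y}"]) auto
      also have "\<dots> \<le> (\<integral>\<^sup>+z. ?a n z * \<delta> z \<partial>count_space UNIV)"
        by (intro nn_integral_mono) (auto simp: indicator_def)
      finally show ?thesis .
    qed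
    then show ?thesis
      unfolding sum_distrib_right using le[of N] by (meson order_trans sum_mono)
  qed
  then have "(\<Sum>n. ?a n y * \<delta> y) \<le> h x"
    by (intro suminf_le_const) (auto simp: sum_distrib_right)
  with h have "(\<Sum>n. ?a n y) * \<delta> y < \<infinity>"
    by simp
  with y(1) show ?case
    by (auto simp: ennreal_mult_less_top)
next
  case (step z w)
  let ?a = "path_weight q x (\<lambda>_. 0)"
  let ?J = "ennreal (jump_prob q z w)"
  have "?a n z * ?J \<le> ?a (Suc n) w" for n
  proof -
    have "?a n z * ?J = (\<integral>\<^sup>+y. ?a n y * ennreal (jump_prob q y w) * indicator {z} y \<partial>count_space UNIV)"
      by (subst nn_integral_count_space'[where A = "{z}"]) auto
    also have "\<dots> \<le> ?a (Suc n) w"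
      unfolding path_weight.simps by (intro nn_integral_mono) (simp add: indicator_def)
    finally show ?thesis .
  qed
  then have "(\<Sum>n. ?a n z * ?J) \<le> (\<Sum>n. ?a (Suc n) w)"
    by (intro suminf_le summableI)
  also have "\<dots> \<le> (\<Sum>n. ?a n w)"
    unfolding suminf_offset[OF summableI, of "\<lambda>n. ?a n w" 1] Suc_eq_plus1
    by (rule add_increasing2[OF zero_le order_refl])
  finally have "(\<Sum>n. ?a n z * ?J) < \<infinity>"
    using step.IH by (rule order.strict_trans1)
  then have "(\<Sum>n. ?a n z) * ?J < \<infinity>"
    by (simp only: ennreal_suminf_multc)
  moreover have "?J \<noteq> 0"
    using step.hyps(1) by simp
  ultimately show ?case
    by (cases "(\<Sum>n. ?a n z) = \<top>") (simp_all only: ennreal_top_mult less_top infinity_ennreal_def if_False refl not_True_eq_False)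
qed

text \<open>By Borel-Cantelli, a finite expected number of visits means that the jump chain is at
  \<open>x\<close> only finitely often. The lower bound \<open>r\<close> on the exit rates makes
  every holding time almost surely finite, so the last visit ends at a finite time.\<close>

theorem transient_ctmcI:
  fixes q :: "('s :: countable) \<Rightarrow> 's \<Rightarrow> real" and h \<delta> :: "'s \<Rightarrow> ennreal"
  assumes q: "\<And>x y. 0 \<le> q x y"
    and r: "0 < r" "\<And>x. r \<le> exit_rate q x"
    and stoch: "\<And>x. (\<integral>\<^sup>+z. ennreal (jump_prob q x z) \<partial>count_space UNIV) = 1"
    and h: "\<And>x. h x < \<infinity>"
    and super: "\<And>x. (\<integral>\<^sup>+z. ennreal (jump_prob q x z) * h z \<partial>count_space UNIV) + \<delta> x \<le> h x"
    and reach: "\<And>x. \<exists>y. 0 < \<delta> y \<and> (x, y) \<in> {(x, y). 0 < jump_prob q x y}\<^sup>*"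
  shows "transient_ctmc TYPE('w) q"
  unfolding transient_ctmc_def
proof (intro allI impI)
  fix M :: "'w measure" and x X
  assume "ctmc_from M q x X"
  then obtain Y S where M: "prob_space M"
    and Y: "\<forall>n. Y n \<in> measurable M (count_space UNIV)"
    and S: "\<forall>n. S n \<in> borel_measurable M"
    and fdd: "\<forall>n y s. (\<forall>k. 0 \<le> s k) \<longrightarrow>
           measure M {\<omega> \<in> space M. (\<forall>k\<le>n. Y k \<omega> = y k) \<and> (\<forall>k<n. ennreal (s k) < S k \<omega>)} =
           of_bool (y 0 = x) *
           (\<Prod>k<n. jump_prob q (y k) (y (Suc k)) * exp (- exit_rate q (y k) * s k))"
    and path: "\<forall>\<omega>\<in>space M. \<forall>t\<ge>0.
           (\<forall>n. jump_time S n \<omega> \<le> ennreal t \<and> ennreal t < jump_time S (Suc n) \<omega>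
                  \<longrightarrow> X t \<omega> = Some (Y n \<omega>)) \<and>
           ((\<forall>n. jump_time S n \<omega> \<le> ennreal t) \<longrightarrow> X t \<omega> = None)"
    unfolding ctmc_from_def by (elim conjE exE) (rule that)
  note Y = Y[rule_format] and S = S[rule_format] and fdd = fdd[THEN spec, THEN spec, THEN spec, THEN mp]
  have X: "X t \<omega> = Some (Y n \<omega>)"
    if "\<omega> \<in> space M" "0 \<le> t" "jump_time S n \<omega> \<le> ennreal t" "ennreal t < jump_time S (Suc n) \<omega>" for \<omega> t n
    using path that by simp
  have X': "X t \<omega> = None"
    if "\<omega> \<in> space M" "0 \<le> t" "\<And>n. jump_time S n \<omega> \<le> ennreal t" for \<omega> t
    using path that by simp
  interpret prob_space M by (rule M)
  have chain: "emeasure M {\<omega> \<in> space M. Y n \<omega> = z \<and> (\<forall>k<n. ennreal (s k) < S k \<omega>)} = path_weight q x s n z"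
    "emeasure M {\<omega> \<in> space M. \<forall>k<n. ennreal (s k) < S k \<omega>} =
      (\<integral>\<^sup>+z. path_weight q x s n z \<partial>count_space UNIV)"
    if "\<And>k. 0 \<le> s k" for s n z
    by (rule emeasure_jump_chain[where q = q, OF M q Y S that]; rule fdd; assumption)+
  have "AE \<omega> in M. \<forall>k<n. 0 < S k \<omega>" for n
  proof (rule AE_I_eq_1)
    show "emeasure M {\<omega> \<in> space M. \<forall>k<n. 0 < S k \<omega>} = 1"
      using chain(2)[of "\<lambda>_. 0" n] by (simp add: nn_integral_path_weight_zero[where q = q, OF q stoch])
    show "{\<omega> \<in> space M. \<forall>k<n. 0 < S k \<omega>} \<in> sets M"
      using S by measurable
  qed
  then have pos: "AE \<omega> in M. 0 < S k \<omega>" for k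
    by (rule AE_mp[of "\<lambda>\<omega>. \<forall>j<Suc k. 0 < S j \<omega>"]) auto
  have fin: "AE \<omega> in M. S n \<omega> < \<infinity>" for n
  proof -
    have "emeasure M {\<omega> \<in> space M. S n \<omega> = \<infinity>} \<le> ennreal (exp (- r * real j))" for j
    proof -
      \<comment> \<open>The threshold \<open>j\<close> is put on holding time \<open>n\<close>
        alone; the others are only asked to be positive, which holds almost surely.\<close>
      define s where "s k = (if k = n then real j else 0)" for k
      have "emeasure M {\<omega> \<in> space M. S n \<omega> = \<infinity>} \<le> emeasure M {\<omega> \<in> space M. \<forall>k<Suc n. ennreal (s k) < S k \<omega>}"
      proof (rule emeasure_mono_AE)
        have "AE \<omega> in M. \<forall>k. 0 < S k \<omega>"
          using pos by (simp add: AE_all_countable)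
        then show "AE \<omega> in M. \<omega> \<in> {\<omega> \<in> space M. S n \<omega> = \<infinity>} \<longrightarrow>
            \<omega> \<in> {\<omega> \<in> space M. \<forall>k<Suc n. ennreal (s k) < S k \<omega>}"
          by eventually_elim (auto simp: s_def)
        show "{\<omega> \<in> space M. \<forall>k<Suc n. ennreal (s k) < S k \<omega>} \<in> sets M"
          using S by measurable
      qed
      also have "\<dots> = (\<integral>\<^sup>+y. path_weight q x s n y * ennreal (exp (- exit_rate q y * s n)) \<partial>count_space UNIV)"
        using chain(2)[of s "Suc n"] nn_integral_path_weight_Suc[where q = q, OF q, where x = x and s = s and n = n and h = "\<lambda>_. 1"]
        by (simp add: stoch s_def del: path_weight.simps)
      also have "\<dots> \<le> (\<integral>\<^sup>+y. path_weight q x s n y * ennreal (exp (- r * real j)) \<partial>count_space UNIV)"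
        by (intro nn_integral_mono mult_left_mono ennreal_leI) (auto simp: s_def r mult_right_mono)
      also have "\<dots> = (\<integral>\<^sup>+y. path_weight q x s n y \<partial>count_space UNIV) * ennreal (exp (- r * real j))"
        by (simp add: nn_integral_multc)
      also have "(\<integral>\<^sup>+y. path_weight q x s n y \<partial>count_space UNIV) = 1"
        using nn_integral_path_weight_zero[where q = q, OF q stoch, of x n]
        by (subst path_weight_cong[of n s "\<lambda>_. 0"]) (auto simp: s_def)
      finally show ?thesis by simp
    qed
    moreover have "(\<lambda>j. ennreal (exp (- r * real j))) \<longlonglongrightarrow> ennreal 0"
      using r(1) by (intro tendsto_ennrealI) real_asymp
    ultimately have "emeasure M {\<omega> \<in> space M. S n \<omega> = \<infinity>} \<le> 0"
      by (intro LIMSEQ_le_const[of "\<lambda>j. ennreal (exp (- r * real j))"]) auto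
    moreover have "{\<omega> \<in> space M. S n \<omega> = \<infinity>} \<in> sets M"
      using S by measurable
    ultimately have "{\<omega> \<in> space M. S n \<omega> = \<infinity>} \<in> null_sets M"
      by (simp add: null_sets_def)
    from AE_not_in[OF this] AE_space show ?thesis
    proof eventually_elim
      case (elim \<omega>)
      then have "S n \<omega> \<noteq> \<top>" by simp
      then show ?case unfolding infinity_ennreal_def less_top .
    qed
  qed
  \<comment> \<open>The conditions \<open>0 < S k\<close> come with the path formula and hold almost
    surely.\<close>
  define A where "A n = {\<omega> \<in> space M. Y n \<omega> = x \<and> (\<forall>k<n. 0 < S k \<omega>)}" for n
  obtain y where "0 < \<delta> y" "(x, y) \<in> {(x, y). 0 < jump_prob q x y}\<^sup>*"
    using reach by blast
  from sum_path_weight_less_top[where q = q and x = x, OF q h super this]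
  have "(\<Sum>n. emeasure M (A n)) < \<infinity>"
    unfolding A_def using chain(1)[of "\<lambda>_. 0"] by simp
  then have "(\<Sum>n. ennreal (measure M (A n))) \<noteq> \<top>"
    unfolding emeasure_eq_measure infinity_ennreal_def by (rule less_imp_neq)
  then have "summable (\<lambda>n. measure M (A n))"
    by (intro summable_suminf_not_top measure_nonneg)
  moreover have "A n \<in> sets M" for n
    unfolding A_def using Y S by measurable
  moreover have "emeasure M (A n) < \<infinity>" for n
    by (simp add: emeasure_eq_measure)
  ultimately have "AE \<omega> in M. eventually (\<lambda>n. \<omega> \<in> space M - A n) sequentially"
    by (intro borel_cantelli_AE1)
  moreover have "AE \<omega> in M. \<forall>k. 0 < S k \<omega> \<and> S k \<omega> < \<infinity>"
    using pos fin by (simp add: AE_all_countable)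
  ultimately show "AE \<omega> in M. bdd_above {t. 0 \<le> t \<and> X t \<omega> = Some x}"
    using AE_space
  proof eventually_elim
    case (elim \<omega>)
    then obtain N where N: "\<And>n. n \<ge> N \<Longrightarrow> Y n \<omega> \<noteq> x"
      unfolding eventually_sequentially A_def by blast
    have "jump_time S N \<omega> < \<infinity>"
      using elim(2) by (simp add: jump_time_def)
    then obtain T where T: "jump_time S N \<omega> = ennreal T" "0 \<le> T"
      by (cases "jump_time S N \<omega>") auto
    show ?case
    proof (rule bdd_aboveI[of _ T])
      fix t assume "t \<in> {t. 0 \<le> t \<and> X t \<omega> = Some x}"
      then have t: "0 \<le> t" "X t \<omega> = Some x" by auto
      then obtain m where m: "ennreal t < jump_time S m \<omega>"
        using X'[OF elim(3), of t] by (metis not_le option.distinct(1))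
      \<comment> \<open>\<open>t\<close> lies in the holding interval of index
        \<open>k = n - 1\<close>, so \<open>Y k\<close> is \<open>x\<close> and \<open>k\<close> is
        less than \<open>N\<close>.\<close>
      define n where "n = (LEAST m. ennreal t < jump_time S m \<omega>)"
      have n: "ennreal t < jump_time S n \<omega>" unfolding n_def using m by (rule LeastI)
      then obtain k where k: "n = Suc k"
        by (cases n) (auto simp: jump_time_def)
      have "jump_time S k \<omega> \<le> ennreal t"
        using not_less_Least[of k "\<lambda>m. ennreal t < jump_time S m \<omega>"] k by (auto simp: n_def not_less)
      then have "Y k \<omega> = x"
        using X[OF elim(3) t(1), of k] n k t(2) by auto
      then have "Suc k \<le> N"
        using N[of k] by (cases "N \<le> k") auto
      then have "jump_time S n \<omega> \<le> jump_time S N \<omega>"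
        unfolding jump_time_def k by (intro sum_mono2) auto
      with n have "ennreal t < ennreal T"
        unfolding T(1) by (rule order.strict_trans2)
      then show "t \<le> T"
        using T(2) t(1) by (simp add: ennreal_less_iff)
    qed
  qed
qed

section \<open>Resolvents of finite symmetric walks\<close>

text \<open>
  \<open>(1 - L)\<inverse> f\<close> for the walk that applies each map \<open>s e\<close> at rate \<open>b\<close>; the
  solution exists (and is unique) when \<open>b \<ge> 0\<close> and the state space is finite.
\<close>

definition resolvent :: "real \<Rightarrow> 'e set \<Rightarrow> ('e \<Rightarrow> 'p \<Rightarrow> 'p) \<Rightarrow> ('p \<Rightarrow> real) \<Rightarrow> 'p \<Rightarrow> real" where
  "resolvent b E s f = (SOME f'. \<forall>p. f' p + b * (\<Sum>e\<in>E. f' p - f' (s e p)) = f p)"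

text \<open>At a point of \<open>P\<close> where \<open>f\<close> is minimal all differences
  \<open>f p - f (s e p)\<close> are at most \<open>0\<close>, so the assumption there gives
  \<open>0 \<le> f p\<close>.\<close>

lemma minimum_principle:
  fixes f :: "'p \<Rightarrow> real"
  assumes b: "0 \<le> b" and P: "finite P" "\<And>e p. e \<in> E \<Longrightarrow> p \<in> P \<Longrightarrow> s e p \<in> P"
    and f: "\<And>p. p \<in> P \<Longrightarrow> 0 \<le> f p + b * (\<Sum>e\<in>E. f p - f (s e p))"
    and q: "q \<in> P"
  shows "0 \<le> f q"
proof -
  have "P \<noteq> {}" using q by auto
  define p where "p = arg_min_on f P"
  have p: "p \<in> P" "\<And>q. q \<in> P \<Longrightarrow> f p \<le> f q"
    using arg_min_if_finite(1)[OF P(1) \<open>P \<noteq> {}\<close>, of f] arg_min_least[OF P(1) \<open>P \<noteq> {}\<close>, of _ f]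
    by (auto simp: p_def)
  have "(\<Sum>e\<in>E. f p - f (s e p)) \<le> 0"
    using p P by (intro sum_nonpos) auto
  with f[OF p(1)] b have "0 \<le> f p"
    by (smt (verit) mult_nonneg_nonpos)
  with p(2)[OF q] show ?thesis by simp
qed

text \<open>The operator \<open>1 - L\<close> is linear on a finite-dimensional space. The minimum
  principle for a kernel vector and for its negative shows that it is injective, hence onto.\<close>

lemma resolvent_eq:
  fixes f :: "'p::finite \<Rightarrow> real"
  assumes b: "0 \<le> b"
  shows "resolvent b E s f p + b * (\<Sum>e\<in>E. resolvent b E s f p - resolvent b E s f (s e p)) = f p"
proof -
  define T :: "real ^ 'p \<Rightarrow> real ^ 'p" where
    "T v = (\<chi> p. v $ p + b * (\<Sum>e\<in>E. v $ p - v $ s e p))" for v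
  have lin: "linear T"
    by (rule linearI)
      (simp_all add: T_def vec_eq_iff sum.distrib sum_subtractf algebra_simps sum_distrib_left)
  have "inj T"
  proof (subst linear_injective_0[OF lin], intro allI impI)
    fix v assume v: "T v = 0"
    have "0 \<le> v $ q" for q
      by (rule minimum_principle[OF b, of UNIV E s])
        (use v in \<open>auto simp: T_def vec_eq_iff\<close>)
    moreover have "0 \<le> - v $ q" for q
    proof (rule minimum_principle[OF b, of UNIV E s])
      fix p
      have "- v $ p + b * (\<Sum>e\<in>E. - v $ p - - v $ s e p) = - (T v $ p)"
        by (simp add: T_def sum_subtractf algebra_simps)
      with v show "0 \<le> - v $ p + b * (\<Sum>e\<in>E. - v $ p - - v $ s e p)" by simp
    qed auto
    ultimately show "v = 0"
      by (simp add: vec_eq_iff order_antisym)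
  qed
  then have "surj T"
    using lin by (simp add: linear_injective_imp_surjective)
  then obtain v where "(\<chi> p. f p) = T v" by (rule surjE)
  then have "\<forall>p. v $ p + b * (\<Sum>e\<in>E. v $ p - v $ s e p) = f p"
    by (simp add: T_def vec_eq_iff)
  then have "\<exists>f'. \<forall>p. f' p + b * (\<Sum>e\<in>E. f' p - f' (s e p)) = f p"
    by (rule exI[of _ "\<lambda>p. v $ p"])
  then show ?thesis
    unfolding resolvent_def by (rule someI2_ex) auto
qed

text \<open>The minimum principle for the resolvent minus \<open>m\<close>, as \<open>1 - L\<close>
  fixes constants.\<close>

lemma resolvent_ge:
  fixes f :: "'p::finite \<Rightarrow> real"
  assumes b: "0 \<le> b" and P: "\<And>e p. e \<in> E \<Longrightarrow> p \<in> P \<Longrightarrow> s e p \<in> P"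
    and f: "\<And>p. p \<in> P \<Longrightarrow> m \<le> f p" and q: "q \<in> P"
  shows "m \<le> resolvent b E s f q"
proof -
  have "0 \<le> (\<lambda>p. resolvent b E s f p - m) q"
    by (rule minimum_principle[where s = s and E = E, OF b _ P]) (use resolvent_eq[OF b, of E s f] f q in \<open>auto simp: algebra_simps\<close>)
  then show ?thesis by simp
qed

lemma resolvent_le:
  fixes f :: "'p::finite \<Rightarrow> real"
  assumes b: "0 \<le> b" and P: "\<And>e p. e \<in> E \<Longrightarrow> p \<in> P \<Longrightarrow> s e p \<in> P"
    and f: "\<And>p. p \<in> P \<Longrightarrow> f p \<le> m" and q: "q \<in> P"
  shows "resolvent b E s f q \<le> m"
proof -
  have "0 \<le> (\<lambda>p. m - resolvent b E s f p) q"
  proof (rule minimum_principle[where s = s and E = E, OF b _ P])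
    fix p assume p: "p \<in> P"
    have "m - resolvent b E s f p + b * (\<Sum>e\<in>E. m - resolvent b E s f p - (m - resolvent b E s f (s e p)))
      = m - f p"
      unfolding resolvent_eq[OF b, of E s f p, symmetric] by (simp add: sum_subtractf algebra_simps)
    with f[OF p] show "0 \<le> m - resolvent b E s f p + b * (\<Sum>e\<in>E. m - resolvent b E s f p - (m - resolvent b E s f (s e p)))"
      by simp
  qed (use q in auto)
  then show ?thesis by simp
qed

lemma resolvent_iterates_bounds:
  fixes f :: "'p::finite \<Rightarrow> real"
  assumes b: "0 \<le> b" and f: "\<And>p. 0 \<le> f p" "\<And>p. f p \<le> 1"
  shows "0 \<le> (resolvent b E s ^^ k) f p \<and> (resolvent b E s ^^ k) f p \<le> 1"
  by (induction k arbitrary: p)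
    (auto simp: f intro!: resolvent_ge[OF b, of E UNIV] resolvent_le[OF b, of E UNIV])

text \<open>Each map is an involution of \<open>P\<close>, so the generator sums to \<open>0\<close>
  over \<open>P\<close>: uniform measure on \<open>P\<close> is invariant.\<close>

lemma sum_resolvent:
  fixes f :: "'p::finite \<Rightarrow> real"
  assumes b: "0 \<le> b" and P: "\<And>e p. e \<in> E \<Longrightarrow> p \<in> P \<Longrightarrow> s e p \<in> P"
    and inv: "\<And>e p. e \<in> E \<Longrightarrow> s e (s e p) = p"
  shows "(\<Sum>p\<in>P. resolvent b E s f p) = (\<Sum>p\<in>P. f p)"
proof -
  let ?r = "resolvent b E s f"
  have "(\<Sum>p\<in>P. ?r (s e p)) = (\<Sum>p\<in>P. ?r p)" if "e \<in> E" for e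
    by (rule sum.reindex_bij_witness[of _ "s e" "s e"]) (use that P inv in auto)
  then have "(\<Sum>p\<in>P. \<Sum>e\<in>E. ?r p - ?r (s e p)) = 0"
    by (subst sum.swap) (simp add: sum_subtractf)
  moreover have "(\<Sum>p\<in>P. f p) = (\<Sum>p\<in>P. ?r p) + b * (\<Sum>p\<in>P. \<Sum>e\<in>E. ?r p - ?r (s e p))"
    by (simp add: resolvent_eq[OF b, of E s f, symmetric] sum.distrib sum_distrib_left)
  ultimately show ?thesis by simp
qed

text \<open>Both sides solve the same equation, and the minimum principle for their difference, with
  either sign, gives uniqueness.\<close>

lemma resolvent_diff_const:
  fixes f :: "'p::finite \<Rightarrow> real"
  assumes b: "0 \<le> b"
  shows "resolvent b E s (\<lambda>p. f p - m) p = resolvent b E s f p - m"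
proof -
  let ?r = "resolvent b E s f" and ?r' = "resolvent b E s (\<lambda>p. f p - m)"
  define d where "d p = ?r' p - (?r p - m)" for p
  have d: "d p + b * (\<Sum>e\<in>E. d p - d (s e p)) = 0" for p
    using resolvent_eq[OF b, of E s f p] resolvent_eq[OF b, of E s "\<lambda>p. f p - m" p]
    by (simp add: d_def sum_subtractf sum.distrib algebra_simps)
  have "0 \<le> d p"
    by (rule minimum_principle[OF b, of UNIV E s]) (auto simp: d)
  moreover have "0 \<le> - d p"
  proof (rule minimum_principle[OF b, of UNIV E s])
    fix p
    have "- d p + b * (\<Sum>e\<in>E. - d p - - d (s e p)) = - (d p + b * (\<Sum>e\<in>E. d p - d (s e p)))"
      by (simp add: sum_subtractf algebra_simps)
    then show "0 \<le> - d p + b * (\<Sum>e\<in>E. - d p - - d (s e p))"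
      by (simp add: d)
  qed auto
  ultimately show ?thesis by (simp add: d_def)
qed

text \<open>From \<open>c f' (q) \<ge> f q + b f' (s e q)\<close> with \<open>c = 1 + b |E|\<close>, iterated along the path.\<close>

lemma resolvent_path_lower_bound:
  fixes s :: "'e \<Rightarrow> 'p::finite \<Rightarrow> 'p"
  assumes b: "0 < b" and E: "finite E" and P: "\<And>e p. e \<in> E \<Longrightarrow> p \<in> P \<Longrightarrow> s e p \<in> P"
    and path: "(q, p) \<in> {(p, s e p) | e p. e \<in> E}\<^sup>*" and q: "q \<in> P"
  shows "\<exists>\<delta>>0. \<forall>f. (\<forall>p\<in>P. 0 \<le> f p) \<longrightarrow> \<delta> * f p \<le> resolvent b E s f q"
  using path q
proof (induction q rule: converse_rtrancl_induct)
  case base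
  define c where "c = 1 + b * card E"
  have c: "c > 0" using b by (simp add: c_def add_pos_nonneg)
  have "inverse c * f p \<le> resolvent b E s f p" if f: "\<forall>p\<in>P. 0 \<le> f p" for f
  proof -
    have "0 \<le> resolvent b E s f (s e p)" if "e \<in> E" for e
      by (rule resolvent_ge[of b E P]) (use b P f base that in auto)
    then have "(\<Sum>e\<in>E. resolvent b E s f p - resolvent b E s f (s e p)) \<le> card E * resolvent b E s f p"
      by (intro order_trans[OF sum_bounded_above[of E _ "resolvent b E s f p"]]) auto
    then have "b * (\<Sum>e\<in>E. resolvent b E s f p - resolvent b E s f (s e p)) \<le> b * (card E * resolvent b E s f p)"
      using b by (intro mult_left_mono) auto
    then have "f p \<le> c * resolvent b E s f p"
      using resolvent_eq[of b E s f p] b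
      unfolding c_def distrib_right mult_1 mult.assoc by linarith
    with c show ?thesis by (simp add: field_simps)
  qed
  with c show ?case by (intro exI[of _ "inverse c"]) auto
next
  case (step q r)
  then obtain e where e: "e \<in> E" "r = s e q" by auto
  with step.IH step.prems P obtain \<delta> where \<delta>: "\<delta> > 0"
    "\<And>f. (\<forall>p\<in>P. 0 \<le> f p) \<Longrightarrow> \<delta> * f p \<le> resolvent b E s f r"
    by metis
  define c where "c = 1 + b * card E"
  have c: "c > 0" using b by (simp add: c_def add_pos_nonneg)
  have "(b * \<delta> / c) * f p \<le> resolvent b E s f q" if f: "\<forall>p\<in>P. 0 \<le> f p" for f
  proof -
    let ?r = "resolvent b E s f"
    have nn: "0 \<le> ?r (s e q)" if "e \<in> E" for e
      by (rule resolvent_ge[of b E P]) (use b P f step.prems that in auto)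
    have "?r r \<le> (\<Sum>e\<in>E. ?r (s e q))"
      unfolding e(2) by (rule member_le_sum) (use e E nn in auto)
    then have "b * ?r r \<le> b * (\<Sum>e\<in>E. ?r (s e q))"
      using b by simp
    moreover have "0 \<le> f q" using f step.prems by auto
    moreover have "c * ?r q = f q + b * (\<Sum>e\<in>E. ?r (s e q))"
      using resolvent_eq[of b E s f q] b by (simp add: c_def algebra_simps sum_subtractf)
    ultimately have "b * ?r r \<le> c * ?r q" by linarith
    moreover have "b * (\<delta> * f p) \<le> b * ?r r"
      using \<delta>(2)[OF f] b by simp
    ultimately show ?thesis using c by (simp add: field_simps)
  qed
  with \<delta>(1) b c show ?case
    by (intro exI[of _ "b * \<delta> / c"]) auto
qed

text \<open>A Doeblin argument. One resolvent raises a lower bound \<open>m\<close> by a fixed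
  fraction \<open>\<delta>\<close> of its gap to the mean, and the mean is preserved, so the gap
  decays like \<open>(1 - \<delta>) ^ k\<close>. One \<open>N\<close> works for all
  \<open>f\<close>, hence for all destinations of customers.\<close>

lemma resolvent_iterates_ge_mean:
  fixes s :: "'e \<Rightarrow> 'p::finite \<Rightarrow> 'p"
  assumes b: "0 < b" and E: "finite E" and P: "\<And>e p. e \<in> E \<Longrightarrow> p \<in> P \<Longrightarrow> s e p \<in> P"
    and inv: "\<And>e p. e \<in> E \<Longrightarrow> s e (s e p) = p"
    and trans: "\<And>p q. p \<in> P \<Longrightarrow> q \<in> P \<Longrightarrow> (q, p) \<in> {(p, s e p) | e p. e \<in> E}\<^sup>*"
    and ne: "P \<noteq> {}" and \<epsilon>: "0 < \<epsilon>"
  shows "\<exists>N. \<forall>f. (\<forall>p. 0 \<le> f p \<and> f p \<le> 1) \<longrightarrow>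
    (\<forall>p\<in>P. (\<Sum>p\<in>P. f p) / card P - \<epsilon> \<le> (resolvent b E s ^^ N) f p)"
proof -
  have "\<exists>\<delta>>0. \<forall>f. (\<forall>p\<in>P. 0 \<le> f p) \<longrightarrow> \<delta> * f p \<le> resolvent b E s f q"
    if "p \<in> P" "q \<in> P" for p q
    using resolvent_path_lower_bound[where s = s, OF b E P trans[OF that] that(2)] .
  then obtain d where d: "\<And>p q. p \<in> P \<Longrightarrow> q \<in> P \<Longrightarrow> 0 < d p q"
    "\<And>p q f. p \<in> P \<Longrightarrow> q \<in> P \<Longrightarrow> (\<forall>p\<in>P. 0 \<le> f p) \<Longrightarrow> d p q * f p \<le> resolvent b E s f q"
    by metis
  \<comment> \<open>Including \<open>1\<close> in the minimum keeps the powers of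
    \<open>1 - \<delta>\<close> nonnegative.\<close>
  define \<delta> where "\<delta> = Min (insert 1 ((\<lambda>(p, q). d p q) ` (P \<times> P)))"
  have \<delta>: "0 < \<delta>" "\<delta> \<le> 1"
    unfolding \<delta>_def using d(1) by (auto simp: Min_gr_iff)
  have \<delta>d: "\<delta> \<le> d p q" if "p \<in> P" "q \<in> P" for p q
    unfolding \<delta>_def using that by (intro Min_le) (auto intro!: image_eqI[of _ _ "(p, q)"])
  have cardP: "card P > 0" using ne by (simp add: card_gt_0_iff)
  define \<mu> where "\<mu> f = (\<Sum>p\<in>P. f p) / card P" for f :: "'p \<Rightarrow> real"
  have step: "m + \<delta> * (\<mu> f - m) \<le> resolvent b E s f q"
    if f: "\<forall>p\<in>P. m \<le> f p" and q: "q \<in> P" for f :: "'p \<Rightarrow> real" and m q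
  proof -
    \<comment> \<open>Some value is at least the mean; the path bound, applied to \<open>f\<close>
      minus \<open>m\<close>, carries its excess over to \<open>q\<close>.\<close>
    have "\<exists>p\<in>P. \<mu> f \<le> f p"
    proof (rule ccontr)
      assume "\<not> ?thesis"
      then have "(\<Sum>p\<in>P. f p) < (\<Sum>p\<in>P. \<mu> f)"
        using ne by (intro sum_strict_mono) auto
      with cardP ne show False by (simp add: \<mu>_def)
    qed
    then obtain p where p: "p \<in> P" "\<mu> f \<le> f p" by auto
    have "\<delta> * (\<mu> f - m) \<le> \<delta> * (f p - m)"
      using \<delta> p by simp
    also have "\<dots> \<le> d p q * (f p - m)"
      using f p q by (intro mult_right_mono \<delta>d) auto
    also have "\<dots> \<le> resolvent b E s (\<lambda>p. f p - m) q"
      using d(2)[OF p(1) q, of "\<lambda>p. f p - m"] f by simp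
    finally show ?thesis
      using b by (simp add: resolvent_diff_const)
  qed
  have \<mu>: "\<mu> ((resolvent b E s ^^ k) f) = \<mu> f" for k f
    by (induction k) (use b P inv in \<open>simp_all add: \<mu>_def sum_resolvent\<close>)
  \<comment> \<open>The iteration starts from the lower bound \<open>0\<close>, whose gap to the
    mean is \<open>\<mu> f\<close>.\<close>
  have iter: "\<mu> f - (1 - \<delta>) ^ k * \<mu> f \<le> (resolvent b E s ^^ k) f q"
    if f: "\<forall>p\<in>P. 0 \<le> f p" and q: "q \<in> P" for f :: "'p \<Rightarrow> real" and k q
    using q
  proof (induction k arbitrary: q)
    case 0
    then show ?case using f by simp
  next
    case (Suc k)
    have "\<mu> f - (1 - \<delta>) ^ Suc k * \<mu> f = (\<mu> f - (1 - \<delta>) ^ k * \<mu> f) +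
        \<delta> * (\<mu> ((resolvent b E s ^^ k) f) - (\<mu> f - (1 - \<delta>) ^ k * \<mu> f))"
      by (simp add: \<mu> algebra_simps)
    also have "\<dots> \<le> resolvent b E s ((resolvent b E s ^^ k) f) q"
      using Suc by (intro step) auto
    finally show ?case by simp
  qed
  have "(\<lambda>k. (1 - \<delta>) ^ k) \<longlonglongrightarrow> 0"
    using \<delta> by (intro LIMSEQ_realpow_zero) auto
  then obtain N where N: "(1 - \<delta>) ^ N < \<epsilon>"
    using \<epsilon> \<delta> by (metis (no_types, lifting) order_tendstoD(2) eventually_sequentially order_refl)
  show ?thesis
  proof (intro exI[of _ N] allI impI ballI)
    fix f :: "'p \<Rightarrow> real" and q assume f: "\<forall>p. 0 \<le> f p \<and> f p \<le> 1" and q: "q \<in> P"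
    have "(\<Sum>p\<in>P. f p) \<le> card P"
      using f sum_bounded_above[of P f 1] by simp
    then have "\<mu> f \<le> 1" "0 \<le> \<mu> f"
      using cardP f by (auto simp: \<mu>_def sum_nonneg)
    then have "(1 - \<delta>) ^ N * \<mu> f \<le> \<epsilon>"
      using N \<delta> by (smt (verit) mult_left_le zero_le_power)
    with iter[of f q N] f q show "(\<Sum>p\<in>P. f p) / card P - \<epsilon> \<le> (resolvent b E s ^^ N) f q"
      by (simp add: \<mu>_def)
  qed
qed

section \<open>Swaps act transitively on pairs of distinct nodes\<close>

text \<open>The action on nodes inside \<open>swap_step\<close>: the swap turns \<open>x\<close>
  into \<open>\<lambda>v. x (edge_swap e v)\<close>.\<close>

definition edge_swap :: "'v set \<Rightarrow> 'v \<Rightarrow> 'v" where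
  "edge_swap e v = (if v \<in> e then the_elem (e - {v}) else v)"

lemma edge_swap_doubleton: "a \<noteq> b \<Longrightarrow> edge_swap {a, b} = Transposition.transpose a b"
  by (auto simp: edge_swap_def fun_eq_iff Transposition.transpose_def insert_Diff_if)

lemma edge_swap_involution:
  assumes "card e = 2"
  shows "edge_swap e (edge_swap e v) = v"
  using assms by (auto simp: card_2_iff edge_swap_doubleton)

lemma edge_swap_eq_iff:
  assumes "card e = 2"
  shows "edge_swap e u = edge_swap e v \<longleftrightarrow> u = v"
  using edge_swap_involution[OF assms] by metis

text \<open>Induction on a walk from \<open>u\<close> to \<open>d\<close>, by the conjugation
  \<open>(u d) = (u w) (w d) (u w)\<close> of transpositions.\<close>

lemma transpose_pair_reachable:
  fixes E :: "'v set set"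
  assumes E: "simple_graph E" and path: "(u, d) \<in> (adjacency E)\<^sup>*"
  shows "(p, map_prod (Transposition.transpose u d) (Transposition.transpose u d) p) \<in>
    {(p, map_prod (edge_swap e) (edge_swap e) p) | e p. e \<in> E}\<^sup>*" (is "_ \<in> ?R\<^sup>*")
  using path
proof (induction u arbitrary: p rule: converse_rtrancl_induct)
  case base
  then show ?case by (cases p) simp
next
  case (step u w)
  let ?m = "\<lambda>a b. map_prod (Transposition.transpose a b) (Transposition.transpose a b)"
  have e: "{u, w} \<in> E" using step by (simp add: adjacency_def)
  with E have "card {u, w} = 2" by (auto simp: simple_graph_def)
  then have "u \<noteq> w" by auto
  then have uw: "(p, ?m u w p) \<in> ?R" for p
    using e edge_swap_doubleton[of u w] by (force intro!: exI[of _ "{u, w}"])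
  show ?case
  \<comment> \<open>The conjugation identity needs \<open>d\<close> to differ from both
    \<open>u\<close> and \<open>w\<close>.\<close>
  proof (cases "d = u \<or> d = w")
    case True
    then show ?thesis
    proof
      assume "d = u"
      then show ?thesis by (cases p) simp
    next
      assume "d = w"
      then show ?thesis using uw by blast
    qed
  next
    case False
    then have "Transposition.transpose u d = Transposition.transpose u w \<circ> Transposition.transpose w d \<circ> Transposition.transpose u w"
      using \<open>u \<noteq> w\<close> by (auto simp: fun_eq_iff Transposition.transpose_def)
    then have "?m u d p = ?m u w (?m w d (?m u w p))"
      by (cases p) simp
    with uw[of p] step.IH[of "?m u w p"] uw[of "?m w d (?m u w p)"] show ?thesis
      by (metis (no_types, lifting) converse_rtrancl_into_rtrancl rtrancl.rtrancl_into_rtrancl)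
  qed
qed

text \<open>First exchange \<open>a\<close> with \<open>c\<close>, then the new place
  \<open>b'\<close> of \<open>b\<close> with \<open>d\<close>. Since \<open>c\<close> is neither
  \<open>b'\<close> nor \<open>d\<close>, the second exchange leaves it alone.\<close>

lemma off_diagonal_reachable:
  fixes E :: "'v set set"
  assumes E: "simple_graph E" "connected_graph E" and ne: "a \<noteq> b" "c \<noteq> d"
  shows "((a, b), (c, d)) \<in> {(p, map_prod (edge_swap e) (edge_swap e) p) | e p. e \<in> E}\<^sup>*"
    (is "_ \<in> ?R\<^sup>*")
proof -
  let ?m = "\<lambda>a b. map_prod (Transposition.transpose a b) (Transposition.transpose a b)"
  have R: "(p, ?m u v p) \<in> ?R\<^sup>*" for p u v
    using E by (intro transpose_pair_reachable) (auto simp: connected_graph_def)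
  define b' where "b' = Transposition.transpose a c b"
  have "b' \<noteq> c" using ne(1) by (auto simp: b'_def Transposition.transpose_def)
  then have "?m b' d (?m a c (a, b)) = (c, d)"
    using ne(2) by (auto simp: b'_def[symmetric])
  with R[of "(a, b)" a c] R[of "?m a c (a, b)" b' d] show ?thesis
    by (metis (no_types, lifting) rtrancl_trans)
qed

section \<open>Generators of finite range\<close>

lemma exit_rate_finite_support:
  assumes "finite {y. q x y \<noteq> 0}"
  shows "exit_rate q x = (\<Sum>y\<in>{y. q x y \<noteq> 0} - {x}. q x y)"
proof -
  have "exit_rate q x = (\<Sum>\<^sub>\<infinity>y\<in>{y. q x y \<noteq> 0} - {x}. q x y)"
    unfolding exit_rate_def by (rule infsum_cong_neutral) auto
  then show ?thesis using assms by simp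
qed

text \<open>The criterion in terms of the generator \<open>G\<close>: dividing by the exit rate
  turns \<open>- G\<close> into the expected decrease \<open>\<delta>\<close> of \<open>h\<close> at
  one jump.\<close>

theorem transient_ctmc_superharmonic:
  fixes q :: "('s :: countable) \<Rightarrow> 's \<Rightarrow> real" and h :: "'s \<Rightarrow> real"
  assumes q: "\<And>x y. 0 \<le> q x y" and fin: "\<And>x. finite {y. q x y \<noteq> 0}"
    and r: "0 < r" "\<And>x. r \<le> exit_rate q x"
    and h: "\<And>x. 0 \<le> h x"
    and super: "\<And>x. (\<Sum>y | q x y \<noteq> 0. q x y * (h y - h x)) \<le> 0"
    and reach: "\<And>x. \<exists>y. (\<Sum>z | q y z \<noteq> 0. q y z * (h z - h y)) < 0 \<and> (x, y) \<in> {(x, y). x \<noteq> y \<and> 0 < q x y}\<^sup>*"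
  shows "transient_ctmc TYPE('w) q"
proof -
  let ?F = "\<lambda>x. {y. q x y \<noteq> 0} - {x}"
  define G where "G x = (\<Sum>y | q x y \<noteq> 0. q x y * (h y - h x))" for x
  have pos: "0 < exit_rate q x" for x
    using r by (rule less_le_trans)
  have exit: "exit_rate q x = (\<Sum>y\<in>?F x. q x y)" for x
    by (rule exit_rate_finite_support[OF fin])
  have J: "(\<integral>\<^sup>+z. ennreal (jump_prob q x z) * ennreal (k z) \<partial>count_space UNIV)
      = ennreal ((\<Sum>z\<in>?F x. q x z * k z) / exit_rate q x)" if "\<And>z. 0 \<le> k z" for x k
  proof -
    have "(\<integral>\<^sup>+z. ennreal (jump_prob q x z) * ennreal (k z) \<partial>count_space UNIV)
      = (\<Sum>z\<in>?F x. ennreal (jump_prob q x z) * ennreal (k z))"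
      using fin pos[of x] by (intro nn_integral_count_space') (auto simp: jump_prob_def)
    also have "\<dots> = (\<Sum>z\<in>?F x. ennreal (q x z * k z / exit_rate q x))"
      using pos[of x] that q by (intro sum.cong) (auto simp: jump_prob_def ennreal_mult[symmetric])
    also have "\<dots> = ennreal (\<Sum>z\<in>?F x. q x z * k z / exit_rate q x)"
      using pos[of x] that q by (intro sum_ennreal) (auto simp: less_imp_le)
    finally show ?thesis by (simp add: sum_divide_distrib)
  qed
  \<comment> \<open>The term \<open>y = x\<close> carries the factor \<open>h x - h x\<close>, so
    the sum can be restricted to actual jumps.\<close>
  have G: "G x = (\<Sum>z\<in>?F x. q x z * h z) - exit_rate q x * h x" for x
  proof -
    have "G x = (\<Sum>z\<in>?F x. q x z * (h z - h x))"
      unfolding G_def using fin by (intro sum.mono_neutral_right) auto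
    also have "\<dots> = (\<Sum>z\<in>?F x. q x z * h z) - exit_rate q x * h x"
      by (simp add: exit algebra_simps sum_subtractf sum_distrib_left)
    finally show ?thesis .
  qed
  show ?thesis
  proof (rule transient_ctmcI[where q = q and r = r and h = "\<lambda>x. ennreal (h x)"
        and \<delta> = "\<lambda>x. ennreal (- G x / exit_rate q x)"])
    show "(\<integral>\<^sup>+z. ennreal (jump_prob q x z) \<partial>count_space UNIV) = 1" for x
      using J[of "\<lambda>_. 1" x] exit[of x] pos[of x] by simp
    show "(\<integral>\<^sup>+z. ennreal (jump_prob q x z) * ennreal (h z) \<partial>count_space UNIV) + ennreal (- G x / exit_rate q x)
      \<le> ennreal (h x)" for x
    proof -
      have "0 \<le> (\<Sum>z\<in>?F x. q x z * h z) / exit_rate q x" "0 \<le> - G x / exit_rate q x"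
        using q h super[of x] pos[of x] by (simp_all add: sum_nonneg G_def divide_nonpos_pos)
      moreover have "(\<Sum>z\<in>?F x. q x z * h z) / exit_rate q x + - G x / exit_rate q x = h x"
        using pos[of x] by (simp add: G field_simps)
      ultimately show ?thesis
        by (simp only: J[OF h] ennreal_plus[symmetric])
    qed
    show "\<exists>y. 0 < ennreal (- G y / exit_rate q y) \<and> (x, y) \<in> {(x, y). 0 < jump_prob q x y}\<^sup>*" for x
    proof -
      obtain y where y: "G y < 0" "(x, y) \<in> {(x, y). x \<noteq> y \<and> 0 < q x y}\<^sup>*"
        using reach[of x] by (auto simp: G_def)
      have "{(x, y). x \<noteq> y \<and> 0 < q x y} \<subseteq> {(x, y). 0 < jump_prob q x y}"
        using pos less_imp_neq[OF pos] by (auto simp: jump_prob_def)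
      then have "(x, y) \<in> {(x, y). 0 < jump_prob q x y}\<^sup>*"
        using y(2) rtrancl_mono by blast
      moreover have "0 < - G y / exit_rate q y"
        using y(1) pos[of y] by (simp add: divide_neg_pos)
      ultimately show ?thesis by auto
    qed
  qed (use q r in auto)
qed

section \<open>Transition rates of the network and reachability of long queues\<close>

lemma finite_set_pmf_steps:
  fixes x :: "'v::finite config"
  shows "finite (set_pmf (arrival_step D v x))" "finite (set_pmf (service_step E v x))"
    "finite (set_pmf (swap_step e x))"
  by (auto simp: arrival_step_def service_step_def swap_step_def split: list.split)

lemma network_rate_nonneg:
  "0 \<le> lam \<Longrightarrow> 0 \<le> bet \<Longrightarrow> 0 \<le> network_rate E lam bet D x y"
  by (auto simp: network_rate_def intro!: add_nonneg_nonneg sum_nonneg mult_nonneg_nonneg)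

text \<open>One ring leads to finitely many configurations, so sums can be exchanged: rates sum to
  the clock rates times the expectations after a ring.\<close>

lemma sum_network_rate:
  fixes E :: "'v::finite set set" and \<phi> :: "'v config \<Rightarrow> real"
  shows "finite {y. network_rate E lam bet D x y \<noteq> 0}" (is "finite ?S")
    and "(\<Sum>y | network_rate E lam bet D x y \<noteq> 0. network_rate E lam bet D x y * \<phi> y) =
      (\<Sum>v\<in>UNIV. lam * measure_pmf.expectation (arrival_step D v x) \<phi>) +
      (\<Sum>v\<in>UNIV. measure_pmf.expectation (service_step E v x) \<phi>) +
      (\<Sum>e\<in>E. bet * measure_pmf.expectation (swap_step e x) \<phi>)"
proof -
  define F where "F = (\<Union>v. set_pmf (arrival_step D v x)) \<union> (\<Union>v. set_pmf (service_step E v x)) \<union>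
    (\<Union>e\<in>E. set_pmf (swap_step e x))"
  have finF: "finite F"
    by (auto simp: F_def finite_set_pmf_steps)
  have S: "?S \<subseteq> F"
  proof
    fix y assume "y \<in> ?S"
    then show "y \<in> F"
      by (rule contrapos_pp) (auto simp: F_def network_rate_def set_pmf_iff)
  qed
  with finF show "finite ?S" by (rule finite_subset[rotated])
  have ex: "measure_pmf.expectation p \<phi> = (\<Sum>y\<in>F. \<phi> y * pmf p y)" if "set_pmf p \<subseteq> F" for p
    using that finF by (intro integral_measure_pmf_real) auto
  have "(\<Sum>y\<in>?S. network_rate E lam bet D x y * \<phi> y) = (\<Sum>y\<in>F. network_rate E lam bet D x y * \<phi> y)"
    using S finF by (intro sum.mono_neutral_left) auto
  also have "\<dots> = (\<Sum>v\<in>UNIV. lam * (\<Sum>y\<in>F. \<phi> y * pmf (arrival_step D v x) y)) +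
      (\<Sum>v\<in>UNIV. \<Sum>y\<in>F. \<phi> y * pmf (service_step E v x) y) +
      (\<Sum>e\<in>E. bet * (\<Sum>y\<in>F. \<phi> y * pmf (swap_step e x) y))"
    unfolding network_rate_def distrib_right sum.distrib sum_distrib_right sum_distrib_left
    by (intro arg_cong2[where f = "(+)"]; subst sum.swap) (auto intro!: sum.cong)
  also have "\<dots> = (\<Sum>v\<in>UNIV. lam * measure_pmf.expectation (arrival_step D v x) \<phi>) +
      (\<Sum>v\<in>UNIV. measure_pmf.expectation (service_step E v x) \<phi>) +
      (\<Sum>e\<in>E. bet * measure_pmf.expectation (swap_step e x) \<phi>)"
    by (intro arg_cong2[where f = "(+)"] sum.cong refl arg_cong2[where f = "(*)"]; subst ex; auto simp: F_def)
  finally show "(\<Sum>y\<in>?S. network_rate E lam bet D x y * \<phi> y) = \<dots>" .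
qed

text \<open>An arrival lengthens a queue, hence always changes the configuration, and arrivals alone
  have total rate at least \<open>lam\<close>.\<close>

lemma exit_rate_network_ge:
  fixes E :: "'v::finite set set"
  assumes "0 \<le> lam" "0 \<le> bet"
  shows "lam \<le> exit_rate (network_rate E lam bet D) x"
proof -
  let ?q = "network_rate E lam bet D" and ?\<phi> = "\<lambda>y. of_bool (y \<noteq> x) :: real"
  have arr: "measure_pmf.expectation (arrival_step D v x) ?\<phi> = 1" for v
  proof -
    have "x(v := x v @ [d]) \<noteq> x" for d by (auto simp: fun_eq_iff)
    then show ?thesis by (simp add: arrival_step_def)
  qed
  \<comment> \<open>Testing with the indicator of \<open>y \<noteq> x\<close> expresses the exit
    rate as a sum over clocks.\<close>
  have "exit_rate ?q x = (\<Sum>y | ?q x y \<noteq> 0. ?q x y * ?\<phi> y)"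
    unfolding exit_rate_finite_support[where q = ?q, OF sum_network_rate(1)]
    using sum_network_rate(1)[of E lam bet D x] by (intro sum.mono_neutral_cong_left) auto
  also have "\<dots> \<ge> (\<Sum>v::'v\<in>UNIV. lam)"
    unfolding sum_network_rate(2) arr using assms
    by (simp add: sum_nonneg)
  also have "(\<Sum>v::'v\<in>UNIV. lam) \<ge> lam"
    using assms by (simp add: mult_le_cancel_right1 Suc_leI)
  finally show ?thesis .
qed

text \<open>Arrivals alone fill the queues, one node after another, with a destination from the
  support of \<open>D v\<close>.\<close>

lemma long_queues_reachable:
  fixes E :: "'v::finite set set"
  assumes "0 < lam" "0 \<le> bet"
  shows "\<exists>y. (x, y) \<in> {(x, y). x \<noteq> y \<and> 0 < network_rate E lam bet D x y}\<^sup>* \<and> (\<forall>v. n \<le> length (y v))"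
    (is "\<exists>y. (x, y) \<in> ?R\<^sup>* \<and> _")
proof -
  have arr: "\<exists>d. \<forall>y. (y, y(v := y v @ [d])) \<in> ?R" for v
  proof -
    obtain d where d: "d \<in> set_pmf (D v)" using set_pmf_not_empty[of "D v"] by auto
    have "(y, y(v := y v @ [d])) \<in> ?R" for y
    proof -
      let ?z = "y(v := y v @ [d])"
      have "?z \<in> set_pmf (arrival_step D v y)" using d by (auto simp: arrival_step_def)
      then have "0 < lam * pmf (arrival_step D v y) ?z"
        using assms by (simp add: pmf_positive)
      also have "\<dots> \<le> (\<Sum>v\<in>UNIV. lam * pmf (arrival_step D v y) ?z)"
        using assms by (intro member_le_sum) auto
      also have "\<dots> \<le> network_rate E lam bet D y ?z"
        using assms by (auto simp: network_rate_def intro!: sum_nonneg add_nonneg_nonneg)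
      finally have "0 < network_rate E lam bet D y ?z" .
      moreover have "y \<noteq> ?z" by (auto simp: fun_eq_iff)
      ultimately show ?thesis by simp
    qed
    then show ?thesis by auto
  qed
  have add: "\<exists>z. (y, z) \<in> ?R\<^sup>* \<and> n \<le> length (z v) \<and> (\<forall>u. u \<noteq> v \<longrightarrow> z u = y u)" for v n y
  proof (induction n)
    case 0
    then show ?case by auto
  next
    case (Suc n)
    then obtain z where z: "(y, z) \<in> ?R\<^sup>*" "n \<le> length (z v)" "\<forall>u. u \<noteq> v \<longrightarrow> z u = y u" by blast
    obtain d where "(z, z(v := z v @ [d])) \<in> ?R" using arr by blast
    with z(1) have "(y, z(v := z v @ [d])) \<in> ?R\<^sup>*" by (rule rtrancl_into_rtrancl)
    moreover have "Suc n \<le> length ((z(v := z v @ [d])) v) \<and> (\<forall>u. u \<noteq> v \<longrightarrow> (z(v := z v @ [d])) u = y u)"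
      using z by simp
    ultimately show ?case by blast
  qed
  have "finite A \<Longrightarrow> \<exists>y. (x, y) \<in> ?R\<^sup>* \<and> (\<forall>v\<in>A. n \<le> length (y v))" for A
  proof (induction A rule: finite_induct)
    case empty
    then show ?case by auto
  next
    case (insert v A)
    then obtain y where y: "(x, y) \<in> ?R\<^sup>*" "\<forall>v\<in>A. n \<le> length (y v)" by blast
    obtain z where z: "(y, z) \<in> ?R\<^sup>*" "n \<le> length (z v)" "\<forall>u. u \<noteq> v \<longrightarrow> z u = y u"
      using add by blast
    have "(x, z) \<in> ?R\<^sup>*" using y(1) z(1) by (rule rtrancl_trans)
    moreover have "\<forall>u\<in>insert v A. n \<le> length (z u)"
      using y(2) z by (metis insertE)
    ultimately show ?case by blast
  qed
  from this[of UNIV] show ?thesis by auto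
qed

section \<open>Drift of the corrected queue lengths\<close>

lemma graph_dist_walk:
  assumes "connected_graph E"
  shows "(u, v) \<in> adjacency E ^^ graph_dist E u v"
proof -
  obtain n where "(u, v) \<in> adjacency E ^^ n"
    using assms by (auto simp: connected_graph_def rtrancl_power)
  then show ?thesis unfolding graph_dist_def by (rule LeastI)
qed

lemma graph_dist_le: "(u, v) \<in> adjacency E ^^ n \<Longrightarrow> graph_dist E u v \<le> n"
  unfolding graph_dist_def by (rule Least_le)

text \<open>The second node of a shortest walk is closer. Hence the routing rule chooses from a
  nonempty set.\<close>

lemma closer_neighbor_exists:
  assumes E: "connected_graph E" and d: "graph_dist E u d \<noteq> 0"
  shows "\<exists>w. {u, w} \<in> E \<and> graph_dist E w d = graph_dist E u d - 1"
proof -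
  obtain m where m: "graph_dist E u d = Suc m" using d by (cases "graph_dist E u d") auto
  with graph_dist_walk[OF E, of u d] obtain w where w: "(u, w) \<in> adjacency E" "(w, d) \<in> adjacency E ^^ m"
    by (metis relpow_Suc_D2)
  have "graph_dist E u d \<le> Suc (graph_dist E w d)"
    by (rule graph_dist_le, rule relpow_Suc_I2[OF w(1) graph_dist_walk[OF E]])
  with graph_dist_le[OF w(2)] m w(1) show ?thesis
    by (intro exI[of _ w]) (auto simp: adjacency_def)
qed

text \<open>Besides \<open>d\<close> itself the ball contains the neighbours of \<open>d\<close>,
  which inject into the edges at \<open>d\<close>. At these nodes a served customer with destination
  \<open>d\<close> leaves.\<close>

lemma card_ball_le:
  fixes E :: "'v::finite set set"
  assumes E: "simple_graph E" "connected_graph E" "regular_graph g E"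
  shows "card {u. graph_dist E u d \<le> 1} \<le> g + 1"
proof -
  let ?N = "{u. {u, d} \<in> E}"
  have "u = d \<or> u \<in> ?N" if "graph_dist E u d \<le> 1" for u
  proof (cases "graph_dist E u d = 0")
    case True
    with graph_dist_walk[OF E(2), of u d] show ?thesis by simp
  next
    case False
    with that have "graph_dist E u d = 1" by simp
    with graph_dist_walk[OF E(2), of u d] show ?thesis by (simp add: adjacency_def)
  qed
  then have "card {u. graph_dist E u d \<le> 1} \<le> card (insert d ?N)"
    by (intro card_mono) auto
  also have "\<dots> \<le> Suc (card ?N)"
    by (rule card_insert_le_m1[THEN order_trans]) auto
  also have "card ?N \<le> card {e \<in> E. d \<in> e}"
  proof (rule card_inj_on_le[where f = "\<lambda>u. {u, d}"])
    show "inj_on (\<lambda>u. {u, d}) ?N" by (auto simp: inj_on_def doubleton_eq_iff)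
  qed auto
  also have "\<dots> = g" using E(3) by (simp add: regular_graph_def)
  finally show ?thesis by simp
qed

section \<open>Second-order bounds for exponential test functions\<close>

lemma exp_le_quadratic:
  fixes z :: real
  assumes "\<bar>z\<bar> \<le> 1"
  shows "exp z \<le> 1 + z + z\<^sup>2"
proof (cases "0 \<le> z")
  case True
  then show ?thesis using assms by (intro exp_bound) auto
next
  case False
  then have "0 < 1 + - z" by simp
  \<comment> \<open>For \<open>z < 0\<close> the bound \<open>1 - z \<le> exp (- z)\<close> gives
    \<open>(1 - z) * exp z \<le> 1\<close>, and
    \<open>(1 - z) * (1 + z + z\<^sup>2) = 1 - z ^ 3\<close> is at least \<open>1\<close>.\<close>
  have "(1 - z) * exp z \<le> exp (- z) * exp z"
    using exp_ge_add_one_self[of "- z"] by (intro mult_right_mono) auto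
  also have "\<dots> = 1" by (simp add: exp_minus)
  also have "1 \<le> (1 - z) * (1 + z + z\<^sup>2)"
  proof -
    have "(1 - z) * (1 + z + z\<^sup>2) = 1 + (- z) * z\<^sup>2"
      by (simp add: algebra_simps power2_eq_square)
    with False show ?thesis by (simp add: mult_nonpos_nonneg)
  qed
  finally show ?thesis using False by (simp add: mult_le_cancel_left)
qed

text \<open>The mean increment enters to first order, with error
  \<open>\<theta>\<^sup>2 * B\<^sup>2\<close>. Only the whole sum \<open>f y\<close> is tied to the
  increments, so \<open>\<Delta> y w\<close> may belong to a server that has moved away from
  \<open>w\<close>.\<close>

lemma expectation_exp_sum_le:
  fixes W :: "'v::finite \<Rightarrow> real" and \<Delta> :: "'s \<Rightarrow> 'v \<Rightarrow> real"
  assumes fin: "finite (set_pmf p)" and \<theta>: "0 \<le> \<theta>" "\<theta> * B \<le> 1"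
    and f: "\<And>y. y \<in> set_pmf p \<Longrightarrow> f y = (\<Sum>w\<in>UNIV. exp (- \<theta> * (W w + \<Delta> y w)))"
    and B: "\<And>y w. y \<in> set_pmf p \<Longrightarrow> \<bar>\<Delta> y w\<bar> \<le> B"
  shows "measure_pmf.expectation p (\<lambda>y. f y - (\<Sum>w\<in>UNIV. exp (- \<theta> * W w))) \<le>
    (\<Sum>w\<in>UNIV. exp (- \<theta> * W w) * (\<theta>\<^sup>2 * B\<^sup>2 - \<theta> * measure_pmf.expectation p (\<lambda>y. \<Delta> y w)))"
proof -
  have int: "integrable (measure_pmf p) k" for k :: "'s \<Rightarrow> real"
    using fin by (rule integrable_measure_pmf_finite)
  have "measure_pmf.expectation p (\<lambda>y. f y - (\<Sum>w\<in>UNIV. exp (- \<theta> * W w))) \<le>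
    measure_pmf.expectation p (\<lambda>y. \<Sum>w\<in>UNIV. exp (- \<theta> * W w) * (\<theta>\<^sup>2 * B\<^sup>2 - \<theta> * \<Delta> y w))"
  proof (rule integral_mono_AE[OF int int], rule AE_pmfI)
    fix y assume y: "y \<in> set_pmf p"
    have "exp (- \<theta> * (W w + \<Delta> y w)) - exp (- \<theta> * W w) \<le> exp (- \<theta> * W w) * (\<theta>\<^sup>2 * B\<^sup>2 - \<theta> * \<Delta> y w)" for w
    proof -
      have "\<bar>- \<theta> * \<Delta> y w\<bar> \<le> \<theta> * B"
        using B[OF y, of w] \<theta> by (simp add: abs_mult mult_left_mono)
      then have "exp (- \<theta> * \<Delta> y w) \<le> 1 + - \<theta> * \<Delta> y w + (- \<theta> * \<Delta> y w)\<^sup>2"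
        "(- \<theta> * \<Delta> y w)\<^sup>2 \<le> (\<theta> * B)\<^sup>2"
        using \<theta>(2) exp_le_quadratic[of "- \<theta> * \<Delta> y w"] by (auto simp flip: abs_le_square_iff)
      then have "exp (- \<theta> * \<Delta> y w) - 1 \<le> \<theta>\<^sup>2 * B\<^sup>2 - \<theta> * \<Delta> y w"
        by (simp add: power_mult_distrib)
      then have "exp (- \<theta> * W w) * (exp (- \<theta> * \<Delta> y w) - 1) \<le> exp (- \<theta> * W w) * (\<theta>\<^sup>2 * B\<^sup>2 - \<theta> * \<Delta> y w)"
        by (intro mult_left_mono) auto
      then show ?thesis
        by (simp add: exp_add[symmetric] algebra_simps)
    qed
    then show "f y - (\<Sum>w\<in>UNIV. exp (- \<theta> * W w)) \<le> (\<Sum>w\<in>UNIV. exp (- \<theta> * W w) * (\<theta>\<^sup>2 * B\<^sup>2 - \<theta> * \<Delta> y w))"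
      unfolding f[OF y] sum_subtractf[symmetric] by (intro sum_mono)
  qed
  also have "\<dots> = (\<Sum>w\<in>UNIV. exp (- \<theta> * W w) * (\<theta>\<^sup>2 * B\<^sup>2 - \<theta> * measure_pmf.expectation p (\<lambda>y. \<Delta> y w)))"
    by (subst Bochner_Integration.integral_sum[OF int]) (simp add: int Bochner_Integration.integral_diff)
  finally show ?thesis .
qed

section \<open>Correctors and their equidistribution\<close>

locale mobile_queues =
  fixes E :: "'v::finite set set" and g :: nat and lam bet :: real and D :: "'v \<Rightarrow> 'v pmf"
  assumes g_pos: "g > 0" and simple: "simple_graph E" and conn: "connected_graph E"
    and reg: "regular_graph g E" and lam_pos: "lam > 0" and bet_pos: "bet > 0"
    and large: "real CARD('v) > (real g + 1) / lam"
begin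

abbreviation next_node :: "'v \<Rightarrow> 'v \<Rightarrow> 'v pmf" where
  "next_node d u \<equiv> pmf_of_set {w. {u, w} \<in> E \<and> graph_dist E w d = graph_dist E u d - 1}"

text \<open>
  Pairs are ordered as (receiving node, serving node); only off-diagonal pairs matter. At distance
  at most \<open>1\<close> the set defining \<open>next_node\<close> may be empty, so this case is separated.
\<close>

definition route_prob :: "'v \<Rightarrow> 'v \<times> 'v \<Rightarrow> real" where
  "route_prob d = (\<lambda>(w, u). if graph_dist E u d \<le> 1 then 0 else pmf (next_node d u) w)"

definition corrector :: "nat \<Rightarrow> 'v \<Rightarrow> 'v \<times> 'v \<Rightarrow> real" where
  "corrector k d = (resolvent bet E (\<lambda>e. map_prod (edge_swap e) (edge_swap e)) ^^ k) (route_prob d)"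

text \<open>The corrected length \<open>W\<^sub>w\<close>. The customer at place \<open>k\<close>,
  counted from \<open>0\<close>, is served at ring number \<open>k + 1\<close>, and
  \<open>Suc k\<close> resolvents average the routing probability over the swaps up to that ring.
  Past the end of a queue \<open>!\<close> gives an unspecified node, for which the correctors still
  lie in \<open>[0, 1]\<close>.\<close>

definition potential :: "nat \<Rightarrow> 'v config \<Rightarrow> 'v \<Rightarrow> real" where
  "potential N x w = length (x w) + (\<Sum>u\<in>-{w}. \<Sum>k<N. corrector (Suc k) (x u ! k) (w, u))"

lemma card_edge: "e \<in> E \<Longrightarrow> card e = 2"
  using simple by (simp add: simple_graph_def)

lemma no_loop: "{v, v} \<notin> E"
  using card_edge[of "{v, v}"] by auto

lemma two_le_card_nodes: "2 \<le> CARD('v)"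
proof -
  obtain v :: 'v where True by auto
  have "card {e \<in> E. v \<in> e} = g" using reg by (simp add: regular_graph_def)
  with g_pos have "{e \<in> E. v \<in> e} \<noteq> {}" by (metis card.empty less_irrefl)
  then obtain e where "e \<in> E" by auto
  then have "card e = 2" by (rule card_edge)
  then show ?thesis using card_mono[of "UNIV :: 'v set" e] by simp
qed

lemma route_prob_bounds: "0 \<le> route_prob d p" "route_prob d p \<le> 1"
  by (auto simp: route_prob_def pmf_le_1 split: prod.split)

lemma corrector_bounds: "0 \<le> corrector k d p" "corrector k d p \<le> 1"
  unfolding corrector_def
  using resolvent_iterates_bounds[of bet "route_prob d" k E _ p] route_prob_bounds bet_pos
  by (simp_all add: less_imp_le)

lemma abs_corrector_diff: "\<bar>corrector k d p - corrector k' d' p'\<bar> \<le> 1"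
  using corrector_bounds[of k d p] corrector_bounds[of k' d' p'] by linarith

text \<open>The resolvent equation, read as the drift of a corrector under the swaps.\<close>

lemma corrector_Suc:
  "bet * (\<Sum>e\<in>E. corrector (Suc k) d (edge_swap e w, edge_swap e u) - corrector (Suc k) d (w, u)) =
    corrector (Suc k) d (w, u) - corrector k d (w, u)"
proof -
  let ?r = "corrector (Suc k) d"
  have "?r (w, u) + bet * (\<Sum>e\<in>E. ?r (w, u) - ?r (map_prod (edge_swap e) (edge_swap e) (w, u))) = corrector k d (w, u)"
    unfolding corrector_def funpow.simps comp_def by (rule resolvent_eq) (use bet_pos in simp)
  then show ?thesis
    by (simp add: sum_subtractf algebra_simps)
qed

lemma set_pmf_next_node:
  assumes "\<not> graph_dist E u d \<le> 1"
  shows "set_pmf (next_node d u) = {w. {u, w} \<in> E \<and> graph_dist E w d = graph_dist E u d - 1}"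
    "u \<notin> set_pmf (next_node d u)"
proof -
  show 1: "set_pmf (next_node d u) = {w. {u, w} \<in> E \<and> graph_dist E w d = graph_dist E u d - 1}"
    using closer_neighbor_exists[OF conn, of u d] assms by (intro set_pmf_of_set) auto
  show "u \<notin> set_pmf (next_node d u)"
    unfolding 1 using no_loop by auto
qed

lemma sum_route_prob:
  "(\<Sum>w\<in>-{u}. route_prob d (w, u)) = of_bool (\<not> graph_dist E u d \<le> 1)"
proof (cases "graph_dist E u d \<le> 1")
  case False
  have "(\<Sum>w\<in>-{u}. route_prob d (w, u)) = (\<Sum>w\<in>-{u}. pmf (next_node d u) w)"
    using False by (simp add: route_prob_def)
  also have "\<dots> = 1"
    using set_pmf_next_node[OF False] by (intro sum_pmf_eq_1) auto
  finally show ?thesis using False by simp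
qed (simp add: route_prob_def)

text \<open>Sum over the receiver first: a serving node contributes \<open>1\<close> unless it is
  within distance \<open>1\<close> of \<open>d\<close>, which excludes at most \<open>g + 1\<close>
  nodes.\<close>

lemma mean_route_prob:
  "(\<Sum>p | fst p \<noteq> snd p. route_prob d p) / card {p :: 'v \<times> 'v. fst p \<noteq> snd p} \<ge> (real CARD('v) - (g + 1)) / (real CARD('v) * (real CARD('v) - 1))"
proof -
  have P: "{p :: 'v \<times> 'v. fst p \<noteq> snd p} = (\<lambda>(u, w). (w, u)) ` (SIGMA u:UNIV. -{u})"
    by (auto simp: image_iff)
  have inj: "inj_on (\<lambda>(u, w). (w, u)) (SIGMA u:(UNIV :: 'v set). -{u})"
    by (auto simp: inj_on_def)
  have "card {p :: 'v \<times> 'v. fst p \<noteq> snd p} = (\<Sum>u\<in>(UNIV :: 'v set). card (-{u}))"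
    unfolding P card_image[OF inj] by (intro card_SigmaI) auto
  also have "\<dots> = CARD('v) * (CARD('v) - 1)"
    by (simp add: Compl_eq_Diff_UNIV)
  finally have c: "real (card {p :: 'v \<times> 'v. fst p \<noteq> snd p}) = real CARD('v) * (real CARD('v) - 1)"
    using two_le_card_nodes by simp
  have "(\<Sum>p | fst p \<noteq> snd p. route_prob d p) = (\<Sum>u\<in>UNIV. \<Sum>w\<in>-{u}. route_prob d (w, u))"
    unfolding P sum.reindex[OF inj] by (subst sum.Sigma) (auto intro!: sum.cong)
  also have "\<dots> = (\<Sum>u\<in>(UNIV :: 'v set). 1 - of_bool (graph_dist E u d \<le> 1))"
    by (intro sum.cong) (auto simp: sum_route_prob)
  also have "\<dots> = real CARD('v) - card {u. graph_dist E u d \<le> 1}"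
    by (simp add: sum_subtractf)
  also have "\<dots> \<ge> real CARD('v) - (g + 1)"
    using card_ball_le[OF simple conn reg, of d] by simp
  finally show ?thesis
    unfolding c using two_le_card_nodes by (intro divide_right_mono) auto
qed

text \<open>The only place where \<open>K > (g + 1) / \<lambda>\<close> is used.\<close>

lemma corrector_tail:
  obtains N \<eta> where "0 < \<eta>"
    "\<And>(d :: 'v \<Rightarrow> 'v) w. \<eta> \<le> lam - 1 + (\<Sum>u\<in>-{w}. corrector N (d u) (w, u))"
proof -
  let ?P = "{p :: 'v \<times> 'v. fst p \<noteq> snd p}" and ?s = "\<lambda>e. map_prod (edge_swap e) (edge_swap e)"
  \<comment> \<open>Half of the limiting drift; below, \<open>\<epsilon>\<close> is so small that
    the errors of the other \<open>CARD('v) - 1\<close> servers use at most the other half.\<close>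
  define \<eta> where "\<eta> = (lam - (g + 1) / real CARD('v)) / 2"
  have K: "real CARD('v) \<ge> 2" using two_le_card_nodes by simp
  have \<eta>: "\<eta> > 0"
    using large lam_pos K by (simp add: \<eta>_def field_simps)
  define \<epsilon> where "\<epsilon> = \<eta> / real CARD('v)"
  have "\<exists>N. \<forall>f. (\<forall>p. 0 \<le> f p \<and> f p \<le> 1) \<longrightarrow>
    (\<forall>p\<in>?P. (\<Sum>p\<in>?P. f p) / card ?P - \<epsilon> \<le> (resolvent bet E ?s ^^ N) f p)"
  proof (rule resolvent_iterates_ge_mean)
    show "(q, p) \<in> {(p, ?s e p) | e p. e \<in> E}\<^sup>*" if "p \<in> ?P" "q \<in> ?P" for p q
      using off_diagonal_reachable[OF simple conn, of "fst q" "snd q" "fst p" "snd p"] that by simp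
    show "?P \<noteq> {}"
      using two_le_card_nodes card_le_Suc0_iff_eq[of "UNIV :: 'v set"] by force
    show "0 < \<epsilon>" using \<eta> K by (simp add: \<epsilon>_def)
  qed (use bet_pos in \<open>auto simp: edge_swap_involution edge_swap_eq_iff card_edge prod_eq_iff\<close>)
  then obtain N where N: "\<And>f p. (\<And>p. 0 \<le> f p \<and> f p \<le> 1) \<Longrightarrow> p \<in> ?P \<Longrightarrow>
    (\<Sum>p\<in>?P. f p) / card ?P - \<epsilon> \<le> (resolvent bet E ?s ^^ N) f p"
    by blast
  have "\<eta> \<le> lam - 1 + (\<Sum>u\<in>-{w}. corrector N (d u) (w, u))" for d :: "'v \<Rightarrow> 'v" and w
  proof -
    have "(real CARD('v) - (g + 1)) / (real CARD('v) * (real CARD('v) - 1)) - \<epsilon> \<le> corrector N (d u) (w, u)" if "u \<noteq> w" for u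
      unfolding corrector_def
      using N[of "route_prob (d u)" "(w, u)"] route_prob_bounds mean_route_prob[of "d u"] that by auto
    then have "(\<Sum>u\<in>-{w}. (real CARD('v) - (g + 1)) / (real CARD('v) * (real CARD('v) - 1)) - \<epsilon>) \<le> (\<Sum>u\<in>-{w}. corrector N (d u) (w, u))"
      by (intro sum_mono) auto
    moreover have "(\<Sum>u\<in>-{w}. (real CARD('v) - (g + 1)) / (real CARD('v) * (real CARD('v) - 1)) - \<epsilon>) = 1 - (g + 1) / real CARD('v) - (real CARD('v) - 1) * \<epsilon>"
      using K two_le_card_nodes by (simp add: Compl_eq_Diff_UNIV field_simps)
    moreover have "(real CARD('v) - 1) * \<epsilon> \<le> \<eta>"
      using K \<eta> by (simp add: \<epsilon>_def field_simps)
    ultimately show ?thesis by (simp add: \<eta>_def)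
  qed
  with \<eta> show thesis by (rule that)
qed

section \<open>Increments of the corrected queue lengths\<close>

text \<open>When the head of \<open>u\<close> is served, place \<open>k\<close> is taken over from
  place \<open>Suc k\<close>; this is the resulting change in the potential of another server
  \<open>w\<close>.\<close>

definition shift_gain :: "nat \<Rightarrow> 'v config \<Rightarrow> 'v \<Rightarrow> 'v \<Rightarrow> real" where
  "shift_gain N x u w = (\<Sum>k<N. corrector (Suc k) (x u ! Suc k) (w, u) - corrector (Suc k) (x u ! k) (w, u))"

lemma abs_sum_corrector_diff:
  "\<bar>\<Sum>k<N. corrector (a k) (b k) (p k) - corrector (a' k) (b' k) (p' k)\<bar> \<le> real N"
proof -
  have "\<bar>\<Sum>k<N. corrector (a k) (b k) (p k) - corrector (a' k) (b' k) (p' k)\<bar> \<le> (\<Sum>k<N. 1)"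
    by (rule order_trans[OF sum_abs]) (intro sum_mono abs_corrector_diff)
  then show ?thesis by simp
qed

lemma potential_ge: "length (x w) \<le> potential N x w"
  by (simp add: potential_def sum_nonneg corrector_bounds)

text \<open>The correction is bounded whatever the queues are, so a large potential forces a long
  queue.\<close>

lemma potential_le: "potential N x w \<le> length (x w) + real CARD('v) * N"
proof -
  have "(\<Sum>k<N. corrector (Suc k) (x u ! k) (w, u)) \<le> N" for u
    using sum_mono[of "{..<N}" _ "\<lambda>_. 1", OF corrector_bounds(2)] by simp
  then have "(\<Sum>u\<in>-{w}. \<Sum>k<N. corrector (Suc k) (x u ! k) (w, u)) \<le> (\<Sum>u\<in>-{w}. real N)"
    by (intro sum_mono)
  also have "\<dots> \<le> (\<Sum>u\<in>(UNIV :: 'v set). real N)"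
    by (intro sum_mono2) auto
  finally show ?thesis by (simp add: potential_def)
qed

text \<open>The new customer stands behind the first \<open>N\<close> places, which alone carry
  correctors.\<close>

lemma potential_arrival:
  assumes "N \<le> length (x v)"
  shows "potential N (x(v := x v @ [d])) w = potential N x w + of_bool (w = v)"
proof -
  have "(\<Sum>k<N. corrector (Suc k) ((x(v := x v @ [d])) u ! k) (w, u)) =
    (\<Sum>k<N. corrector (Suc k) (x u ! k) (w, u))" for u
    using assms by (intro sum.cong) (auto simp: nth_append)
  then show ?thesis by (simp add: potential_def del: fun_upd_apply) simp
qed

lemma potential_departure:
  assumes "N < length (x u)"
  shows "potential N (x(u := tl (x u))) w = potential N x w + (if w = u then -1 else shift_gain N x u w)"
proof -
  have "(\<Sum>k<N. corrector (Suc k) ((x(u := tl (x u))) u' ! k) (w, u')) =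
    (\<Sum>k<N. corrector (Suc k) (x u' ! k) (w, u')) + (if u' = u then shift_gain N x u w else 0)" for u'
    using assms by (auto simp: shift_gain_def sum_subtractf nth_tl intro!: sum.cong)
  then have "(\<Sum>u'\<in>-{w}. \<Sum>k<N. corrector (Suc k) ((x(u := tl (x u))) u' ! k) (w, u')) =
    (\<Sum>u'\<in>-{w}. \<Sum>k<N. corrector (Suc k) (x u' ! k) (w, u')) + (if w = u then 0 else shift_gain N x u w)"
    by (simp add: sum.distrib sum.delta del: fun_upd_apply)
  moreover have "real (length ((x(u := tl (x u))) w)) = length (x w) + (if w = u then -1 else 0)"
    using assms by (auto simp: of_nat_diff)
  ultimately show ?thesis by (simp add: potential_def del: fun_upd_apply)
qed

text \<open>Queues travel with their servers, so the server from \<open>w\<close>, now at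
  \<open>edge_swap e w\<close>, keeps its length; only the positions in the correctors
  change.\<close>

lemma potential_swap:
  assumes "e \<in> E"
  shows "potential N (\<lambda>v. x (edge_swap e v)) (edge_swap e w) = potential N x w +
    (\<Sum>u\<in>-{w}. \<Sum>k<N. corrector (Suc k) (x u ! k) (edge_swap e w, edge_swap e u) - corrector (Suc k) (x u ! k) (w, u))"
proof -
  note e = edge_swap_involution[OF card_edge[OF assms]]
  have "(\<Sum>u\<in>-{edge_swap e w}. \<Sum>k<N. corrector (Suc k) (x (edge_swap e u) ! k) (edge_swap e w, u)) =
    (\<Sum>u\<in>-{w}. \<Sum>k<N. corrector (Suc k) (x u ! k) (edge_swap e w, edge_swap e u))"
    by (rule sum.reindex_bij_witness[of _ "edge_swap e" "edge_swap e"]) (use e edge_swap_eq_iff[OF card_edge[OF assms]] in auto)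
  then show ?thesis by (simp add: potential_def e sum_subtractf)
qed

text \<open>After a swap the potential is read at the new position of the same server.\<close>

definition swap_gain :: "nat \<Rightarrow> 'v config \<Rightarrow> 'v set \<Rightarrow> 'v \<Rightarrow> real" where
  "swap_gain N x e w =
    (\<Sum>u\<in>-{w}. \<Sum>k<N. corrector (Suc k) (x u ! k) (edge_swap e w, edge_swap e u) - corrector (Suc k) (x u ! k) (w, u))"

text \<open>Expected increment when the clock at \<open>u\<close> rings: \<open>corrector 0\<close>
  is the probability that the served customer is routed to \<open>w\<close>.\<close>

definition service_gain :: "nat \<Rightarrow> 'v config \<Rightarrow> 'v \<Rightarrow> 'v \<Rightarrow> real" where
  "service_gain N x u w = (if w = u then -1 else shift_gain N x u w + corrector 0 (x u ! 0) (w, u))"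

text \<open>For each \<open>u\<close>, shift and swaps together contribute
  \<open>corrector (Suc k) (x u ! Suc k) - corrector k (x u ! k)\<close> at place \<open>k\<close>,
  which telescopes. The lower end cancels against the routed customer; the upper end remains.
  Arrivals and services at \<open>w\<close> itself give \<open>lam - 1\<close>.\<close>

lemma drift_identity:
  "lam + (\<Sum>u\<in>UNIV. service_gain N x u w) + bet * (\<Sum>e\<in>E. swap_gain N x e w) =
    lam - 1 + (\<Sum>u\<in>-{w}. corrector N (x u ! N) (w, u))"
proof -
  have "(\<Sum>u\<in>UNIV. service_gain N x u w) = service_gain N x w w + (\<Sum>u\<in>UNIV - {w}. service_gain N x u w)"
    by (rule sum.remove) auto
  also have "\<dots> = -1 + (\<Sum>u\<in>-{w}. shift_gain N x u w + corrector 0 (x u ! 0) (w, u))"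
    unfolding Compl_eq_Diff_UNIV by (intro arg_cong2[where f = "(+)"] sum.cong) (auto simp: service_gain_def)
  finally have serv: "(\<Sum>u\<in>UNIV. service_gain N x u w) = \<dots>" .
  have "bet * (\<Sum>e\<in>E. swap_gain N x e w) = (\<Sum>u\<in>-{w}. \<Sum>k<N.
      bet * (\<Sum>e\<in>E. corrector (Suc k) (x u ! k) (edge_swap e w, edge_swap e u) - corrector (Suc k) (x u ! k) (w, u)))"
    unfolding swap_gain_def sum_distrib_left
    by (subst sum.swap, intro sum.cong refl, subst sum.swap, rule refl)
  also have "\<dots> = (\<Sum>u\<in>-{w}. \<Sum>k<N. corrector (Suc k) (x u ! k) (w, u) - corrector k (x u ! k) (w, u))"
    unfolding corrector_Suc ..
  finally have swap: "bet * (\<Sum>e\<in>E. swap_gain N x e w) = \<dots>" .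
  have "shift_gain N x u w + corrector 0 (x u ! 0) (w, u) +
      (\<Sum>k<N. corrector (Suc k) (x u ! k) (w, u) - corrector k (x u ! k) (w, u)) = corrector N (x u ! N) (w, u)" for u
    using sum_lessThan_telescope[of "\<lambda>k. corrector k (x u ! k) (w, u)" N]
    by (simp add: shift_gain_def sum_subtractf)
  then have "(\<Sum>u\<in>-{w}. shift_gain N x u w + corrector 0 (x u ! 0) (w, u)) +
      (\<Sum>u\<in>-{w}. \<Sum>k<N. corrector (Suc k) (x u ! k) (w, u) - corrector k (x u ! k) (w, u)) =
      (\<Sum>u\<in>-{w}. corrector N (x u ! N) (w, u))"
    unfolding sum.distrib[symmetric] by simp
  then show ?thesis unfolding serv swap by simp
qed

text \<open>A departure followed by an arrival; as \<open>v \<noteq> u\<close>, the departure leaves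
  the queue of \<open>v\<close> unchanged.\<close>

lemma potential_routing:
  assumes N: "N < length (x u)" "N \<le> length (x v)" and "v \<noteq> u"
  shows "potential N (x(u := tl (x u), v := x v @ [d])) w =
    potential N x w + (if w = u then -1 else shift_gain N x u w) + of_bool (w = v)"
proof -
  let ?y = "x(u := tl (x u))"
  have "x(u := tl (x u), v := x v @ [d]) = ?y(v := ?y v @ [d])"
    using \<open>v \<noteq> u\<close> by simp
  moreover have "N \<le> length (?y v)" using assms by simp
  ultimately show ?thesis
    using potential_arrival[of N ?y v d w] potential_departure[of N x u w, OF N(1)] by simp
qed

lemma service_step_cases:
  assumes long: "\<And>v. N < length (x v)" and y: "y \<in> set_pmf (service_step E u x)"
  obtains (leave) "graph_dist E u (x u ! 0) \<le> 1" "y = x(u := tl (x u))"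
  | (route) v where "\<not> graph_dist E u (x u ! 0) \<le> 1" "v \<noteq> u" "y = x(u := tl (x u), v := x v @ [x u ! 0])"
proof -
  obtain d ds where x: "x u = d # ds" using long[of u] by (cases "x u") auto
  show thesis
  proof (cases "graph_dist E u d \<le> 1")
    case True
    then show thesis using y leave by (simp add: service_step_def x)
  next
    case False
    then obtain v where v: "v \<in> set_pmf (next_node d u)" "y = x(u := tl (x u), v := x v @ [d])"
      using y by (auto simp: service_step_def x)
    then have "v \<noteq> u" using set_pmf_next_node(2)[OF False] by auto
    with v False show thesis using route by (simp add: x)
  qed
qed

lemma service_increment_bound:
  assumes long: "\<And>v. N < length (x v)" and y: "y \<in> set_pmf (service_step E u x)"
  shows "\<bar>potential N y w - potential N x w\<bar> \<le> N + 1"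
proof -
  have sg: "\<bar>shift_gain N x u w\<bar> \<le> N"
    unfolding shift_gain_def by (rule abs_sum_corrector_diff)
  from long y show ?thesis
  proof (cases rule: service_step_cases)
    case leave
    then show ?thesis using sg potential_departure[of N x u w] long by auto
  next
    case (route v)
    then show ?thesis
      using sg potential_routing[of N x u v "x u ! 0" w, OF long less_imp_le[OF long]] by auto
  qed
qed

lemma expectation_service:
  assumes long: "\<And>v. N < length (x v)"
  shows "measure_pmf.expectation (service_step E u x) (\<lambda>y. potential N y w - potential N x w) = service_gain N x u w"
proof -
  obtain d ds where x: "x u = d # ds" using long[of u] by (cases "x u") auto
  show ?thesis
  proof (cases "graph_dist E u d \<le> 1")
    case True
    then have "service_step E u x = return_pmf (x(u := tl (x u)))" by (simp add: service_step_def x)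
    \<comment> \<open>A customer about to leave has routing probability \<open>0\<close>, which
      matches \<open>service_gain\<close>.\<close>
    moreover have "corrector 0 d (w, u) = 0"
      using True by (simp add: corrector_def route_prob_def)
    ultimately show ?thesis
      using potential_departure[of N x u w, OF long] by (simp add: service_gain_def x)
  next
    case False
    let ?y = "\<lambda>v. x(u := tl (x u), v := x v @ [d])" and ?c = "if w = u then -1 else shift_gain N x u w"
    have "service_step E u x = map_pmf ?y (next_node d u)"
      using False by (simp add: service_step_def x)
    then have "measure_pmf.expectation (service_step E u x) (\<lambda>y. potential N y w - potential N x w) =
      measure_pmf.expectation (next_node d u) (\<lambda>v. potential N (?y v) w - potential N x w)"
      by (simp del: fun_upd_apply)
    also have "\<dots> = measure_pmf.expectation (next_node d u) (\<lambda>v. ?c + indicator {w} v)"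
    proof (rule integral_cong_AE, simp, simp, rule AE_pmfI)
      fix v assume "v \<in> set_pmf (next_node d u)"
      then have "v \<noteq> u" using set_pmf_next_node(2)[OF False] by auto
      then show "potential N (?y v) w - potential N x w = ?c + indicator {w} v"
        using potential_routing[of N x u v d w, OF long less_imp_le[OF long]] by (simp add: indicator_def)
    qed
    also have "\<dots> = ?c + pmf (next_node d u) w"
      by (subst Bochner_Integration.integral_add) (simp_all add: pmf.rep_eq integrable_measure_pmf_finite)
    also have "\<dots> = service_gain N x u w"
    \<comment> \<open>Without loops no customer is routed back to its own server, so the increment
      at \<open>u\<close> is exactly \<open>-1\<close>.\<close>
    proof (cases "w = u")
      case True
      then have "pmf (next_node d u) w = 0"
        using set_pmf_next_node(2)[OF False] by (simp add: set_pmf_iff)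
      with True show ?thesis by (simp add: service_gain_def)
    qed (use False in \<open>simp add: service_gain_def x corrector_def route_prob_def\<close>)
    finally show ?thesis .
  qed
qed

lemma swap_gain_bound: "\<bar>swap_gain N x e w\<bar> \<le> real CARD('v) * N"
proof -
  have "\<bar>swap_gain N x e w\<bar> \<le> (\<Sum>u\<in>-{w}. real N)"
    unfolding swap_gain_def by (rule order_trans[OF sum_abs]) (intro sum_mono abs_sum_corrector_diff)
  also have "\<dots> \<le> (\<Sum>u\<in>(UNIV :: 'v set). real N)"
    by (intro sum_mono2) auto
  finally show ?thesis by simp
qed

section \<open>The Lyapunov function and transience\<close>

definition lyapunov :: "real \<Rightarrow> nat \<Rightarrow> 'v config \<Rightarrow> real" where
  "lyapunov \<theta> N x = (\<Sum>w\<in>UNIV. exp (- \<theta> * potential N x w))"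

definition generator :: "('v config \<Rightarrow> real) \<Rightarrow> 'v config \<Rightarrow> real" where
  "generator h x = (\<Sum>y | network_rate E lam bet D x y \<noteq> 0. network_rate E lam bet D x y * (h y - h x))"

text \<open>To first order each exponential decreases at relative rate \<open>\<theta>\<close> times
  the drift of its potential, at least \<open>\<theta> * \<eta>\<close>. The quadratic errors add up
  to \<open>\<theta>\<^sup>2 * B\<^sup>2\<close> times the total clock rate, which is
  smaller.\<close>

lemma lyapunov_drift:
  assumes long: "\<And>v. N < length (x v)"
    and tail: "\<And>w. \<eta> \<le> lam - 1 + (\<Sum>u\<in>-{w}. corrector N (x u ! N) (w, u))"
    and \<theta>: "0 < \<theta>" "\<theta> * B \<le> 1" "\<theta> * B\<^sup>2 * (lam * CARD('v) + CARD('v) + bet * card E) < \<eta>"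
    and B: "B = real CARD('v) * N + N + 1"
  shows "generator (lyapunov \<theta> N) x < 0"
proof -
  define W where "W = potential N x"
  \<comment> \<open>\<open>R\<close> is the total rate of all clocks, and \<open>U c\<close> bounds
    the mean change of the Lyapunov function at a ring with expected gains \<open>c\<close>.\<close>
  define R where "R = lam * CARD('v) + CARD('v) + bet * card E"
  define U where "U c = (\<Sum>w\<in>UNIV. exp (- \<theta> * W w) * (\<theta>\<^sup>2 * B\<^sup>2 - \<theta> * c w))" for c :: "'v \<Rightarrow> real"
  let ?\<phi> = "\<lambda>y. lyapunov \<theta> N y - lyapunov \<theta> N x"
  have \<phi>: "?\<phi> = (\<lambda>y. lyapunov \<theta> N y - (\<Sum>w\<in>UNIV. exp (- \<theta> * W w)))"
    by (simp add: lyapunov_def W_def)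
  \<comment> \<open>Increment bounds for a service, an arrival and a swap, in this order.\<close>
  have B1: "real N + 1 \<le> B" "1 \<le> B" "real CARD('v) * N \<le> B"
    by (simp_all add: B)
  have arr: "measure_pmf.expectation (arrival_step D v x) ?\<phi> \<le> U (\<lambda>w. of_bool (w = v))" for v
  proof -
    have y: "potential N y w - W w = of_bool (w = v)" if "y \<in> set_pmf (arrival_step D v x)" for y w
      using that potential_arrival[of N x v _ w] long[of v] by (auto simp: arrival_step_def W_def simp del: fun_upd_apply)
    have "measure_pmf.expectation (arrival_step D v x) ?\<phi> \<le>
      U (\<lambda>w. measure_pmf.expectation (arrival_step D v x) (\<lambda>y. potential N y w - W w))"
      unfolding \<phi> U_def
    proof (rule expectation_exp_sum_le[OF finite_set_pmf_steps(1) _ \<theta>(2)])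
      show "\<bar>potential N z w - W w\<bar> \<le> B" if "z \<in> set_pmf (arrival_step D v x)" for z w
        using y[OF that, of w] B1(2) by simp
    qed (use \<theta> in \<open>auto simp: lyapunov_def\<close>)
    moreover have "measure_pmf.expectation (arrival_step D v x) (\<lambda>y. potential N y w - W w) = of_bool (w = v)" for w
    proof -
      have "measure_pmf.expectation (arrival_step D v x) (\<lambda>y. potential N y w - W w) =
        measure_pmf.expectation (arrival_step D v x) (\<lambda>_. of_bool (w = v))"
        by (rule integral_cong_AE, simp, simp, rule AE_pmfI, rule y)
      then show ?thesis by simp
    qed
    ultimately show ?thesis by (simp only:)
  qed
  have srv: "measure_pmf.expectation (service_step E u x) ?\<phi> \<le> U (service_gain N x u)" for u
  proof -
    have "measure_pmf.expectation (service_step E u x) ?\<phi> \<le>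
      U (\<lambda>w. measure_pmf.expectation (service_step E u x) (\<lambda>y. potential N y w - W w))"
      unfolding \<phi> U_def
    proof (rule expectation_exp_sum_le[OF finite_set_pmf_steps(2) _ \<theta>(2)])
      show "\<bar>potential N y w - W w\<bar> \<le> B" if "y \<in> set_pmf (service_step E u x)" for y w
        using service_increment_bound[OF long that, of w] B1(1) by (simp add: W_def)
    qed (use \<theta> in \<open>auto simp: lyapunov_def\<close>)
    then show ?thesis
      using expectation_service[where x = x, OF long] by (simp add: W_def)
  qed
  have swp: "measure_pmf.expectation (swap_step e x) ?\<phi> \<le> U (swap_gain N x e)" if e: "e \<in> E" for e
  proof -
    have step: "swap_step e x = return_pmf (\<lambda>v. x (edge_swap e v))"
      unfolding swap_step_def edge_swap_def by (rule arg_cong[where f = return_pmf]) auto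
    have "measure_pmf.expectation (swap_step e x) ?\<phi> \<le>
      U (\<lambda>w. measure_pmf.expectation (swap_step e x) (\<lambda>y. swap_gain N x e w))"
      unfolding \<phi> U_def
    proof (rule expectation_exp_sum_le[OF finite_set_pmf_steps(3) _ \<theta>(2)])
      fix y assume "y \<in> set_pmf (swap_step e x)"
      then have y: "y = (\<lambda>v. x (edge_swap e v))" by (simp add: step)
      \<comment> \<open>Servers are indexed by their positions before the swap.\<close>
      have "lyapunov \<theta> N y = (\<Sum>w\<in>UNIV. exp (- \<theta> * potential N y (edge_swap e w)))"
        unfolding lyapunov_def
        by (rule sum.reindex_bij_witness[of _ "edge_swap e" "edge_swap e"])
          (use edge_swap_involution[OF card_edge[OF e]] in auto)
      then show "lyapunov \<theta> N y = (\<Sum>w\<in>UNIV. exp (- \<theta> * (W w + swap_gain N x e w)))"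
        using potential_swap[OF e, of N x] by (simp add: y W_def swap_gain_def)
      show "\<bar>swap_gain N x e w\<bar> \<le> B" for w
        using swap_gain_bound[of N x e w] B1(3) by linarith
    qed (use \<theta> in auto)
    then show ?thesis by simp
  qed
  have "generator (lyapunov \<theta> N) x = (\<Sum>v\<in>UNIV. lam * measure_pmf.expectation (arrival_step D v x) ?\<phi>) +
      (\<Sum>v\<in>UNIV. measure_pmf.expectation (service_step E v x) ?\<phi>) +
      (\<Sum>e\<in>E. bet * measure_pmf.expectation (swap_step e x) ?\<phi>)"
    unfolding generator_def by (rule sum_network_rate(2))
  also have "\<dots> \<le> (\<Sum>v\<in>UNIV. lam * U (\<lambda>w. of_bool (w = v))) + (\<Sum>v\<in>UNIV. U (service_gain N x v)) +
      (\<Sum>e\<in>E. bet * U (swap_gain N x e))"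
    using lam_pos bet_pos by (intro add_mono sum_mono mult_left_mono arr srv swp) auto
  also have "\<dots> = (\<Sum>w\<in>UNIV. exp (- \<theta> * W w) *
      (\<theta>\<^sup>2 * B\<^sup>2 * R - \<theta> * (lam + (\<Sum>u\<in>UNIV. service_gain N x u w) + bet * (\<Sum>e\<in>E. swap_gain N x e w))))"
  proof -
    \<comment> \<open>\<open>U\<close> is affine in the gains through the linear functional
      \<open>V\<close>, so the bounds of all clocks combine into one.\<close>
    define V where "V c = (\<Sum>w\<in>UNIV. exp (- \<theta> * W w) * c w)" for c :: "'v \<Rightarrow> real"
    have U: "U c = \<theta>\<^sup>2 * B\<^sup>2 * V (\<lambda>_. 1) - \<theta> * V c" for c
      unfolding U_def V_def sum_distrib_left sum_subtractf[symmetric]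
      by (intro sum.cong refl) (simp add: algebra_simps)
    have V_sum: "(\<Sum>i\<in>I. V (c i)) = V (\<lambda>w. \<Sum>i\<in>I. c i w)" for I :: "'i set" and c
      unfolding V_def sum_distrib_left by (rule sum.swap)
    have V_add: "V (\<lambda>w. c w + c' w) = V c + V c'" for c c'
      by (simp add: V_def distrib_left sum.distrib)
    have V_mult: "V (\<lambda>w. a * c w) = a * V c" for a c
      unfolding V_def sum_distrib_left by (intro sum.cong refl) (rule mult.left_commute)
    have one: "(\<Sum>v\<in>UNIV. V (\<lambda>w. of_bool (w = v))) = V (\<lambda>_. 1)"
      unfolding V_sum by (rule arg_cong[where f = V]) (simp add: of_bool_def fun_eq_iff)
    have "(\<Sum>v\<in>UNIV. lam * U (\<lambda>w. of_bool (w = v))) =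
      \<theta>\<^sup>2 * B\<^sup>2 * V (\<lambda>_. 1) * (lam * CARD('v)) - \<theta> * (lam * V (\<lambda>_. 1))"
      unfolding U sum_distrib_left[symmetric] sum_subtractf one by (simp add: algebra_simps)
    moreover have "(\<Sum>v\<in>UNIV. U (service_gain N x v)) =
      \<theta>\<^sup>2 * B\<^sup>2 * V (\<lambda>_. 1) * CARD('v) - \<theta> * V (\<lambda>w. \<Sum>u\<in>UNIV. service_gain N x u w)"
      unfolding U sum_distrib_left[symmetric] sum_subtractf V_sum[of "service_gain N x" UNIV] by simp
    moreover have "(\<Sum>e\<in>E. bet * U (swap_gain N x e)) =
      \<theta>\<^sup>2 * B\<^sup>2 * V (\<lambda>_. 1) * (bet * card E) - \<theta> * (bet * V (\<lambda>w. \<Sum>e\<in>E. swap_gain N x e w))"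
      unfolding U sum_distrib_left[symmetric] sum_subtractf V_sum[of "swap_gain N x" E] by (simp add: algebra_simps)
    moreover have "(\<Sum>w\<in>UNIV. exp (- \<theta> * W w) *
      (\<theta>\<^sup>2 * B\<^sup>2 * R - \<theta> * (lam + (\<Sum>u\<in>UNIV. service_gain N x u w) + bet * (\<Sum>e\<in>E. swap_gain N x e w)))) =
      \<theta>\<^sup>2 * B\<^sup>2 * R * V (\<lambda>_. 1) -
      \<theta> * V (\<lambda>w. lam * 1 + (\<Sum>u\<in>UNIV. service_gain N x u w) + bet * (\<Sum>e\<in>E. swap_gain N x e w))"
      unfolding V_def sum_distrib_left[of "\<theta>\<^sup>2 * B\<^sup>2 * R"] sum_distrib_left[of \<theta>] sum_subtractf[symmetric]
      by (intro sum.cong refl) (simp only: right_diff_distrib mult_1_right mult_1_left ac_simps)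
    ultimately show ?thesis
      unfolding V_add V_mult R_def by (simp add: algebra_simps)
  qed
  also have "\<dots> < (\<Sum>w\<in>(UNIV :: 'v set). 0)"
  proof (rule sum_strict_mono)
    fix w
    have "\<theta>\<^sup>2 * B\<^sup>2 * R = \<theta> * (\<theta> * B\<^sup>2 * R)" by (simp add: power2_eq_square)
    also have "\<dots> < \<theta> * \<eta>" using \<theta> by (simp add: R_def)
    also have "\<dots> \<le> \<theta> * (lam + (\<Sum>u\<in>UNIV. service_gain N x u w) + bet * (\<Sum>e\<in>E. swap_gain N x e w))"
      unfolding drift_identity using tail[of w] \<theta> by simp
    finally show "exp (- \<theta> * W w) *
      (\<theta>\<^sup>2 * B\<^sup>2 * R - \<theta> * (lam + (\<Sum>u\<in>UNIV. service_gain N x u w) + bet * (\<Sum>e\<in>E. swap_gain N x e w))) < 0"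
      by (simp add: mult_pos_neg)
  qed auto
  finally show ?thesis by simp
qed

lemma generator_mono:
  assumes "\<And>y. h y - h x \<le> k y - k x"
  shows "generator h x \<le> generator k x"
  unfolding generator_def using assms lam_pos bet_pos
  by (intro sum_mono mult_left_mono network_rate_nonneg) auto

text \<open>The superharmonic function is the Lyapunov function cut off at a level below which all
  queues are long.\<close>

theorem transient: "transient_ctmc TYPE('w) (network_rate E lam bet D)"
proof -
  obtain N \<eta> where \<eta>: "0 < \<eta>"
    and tail: "\<And>(d :: 'v \<Rightarrow> 'v) w. \<eta> \<le> lam - 1 + (\<Sum>u\<in>-{w}. corrector N (d u) (w, u))"
    by (rule corrector_tail, rule that)
  define B where "B = real CARD('v) * N + N + 1"
  define R where "R = lam * CARD('v) + CARD('v) + bet * card E"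
  have B: "B > 0" by (simp add: B_def add_nonneg_pos)
  have R: "R > 0" unfolding R_def using lam_pos bet_pos
    by (intro add_pos_nonneg add_pos_pos) simp_all
  \<comment> \<open>The first bound gives \<open>\<theta> * B \<le> 1\<close>; the second keeps
    \<open>\<theta> * B\<^sup>2 * R\<close> at most \<open>\<eta> / 2\<close>.\<close>
  define \<theta> where "\<theta> = min (1 / B) (\<eta> / (2 * (B\<^sup>2 * R)))"
  have "\<theta> * B \<le> 1 / B * B"
    using B by (intro mult_right_mono) (simp_all add: \<theta>_def)
  with B R \<eta> have \<theta>: "0 < \<theta>" "\<theta> * B \<le> 1"
    by (simp_all add: \<theta>_def)
  have "\<theta> * (B\<^sup>2 * R) \<le> \<eta> / (2 * (B\<^sup>2 * R)) * (B\<^sup>2 * R)"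
    using B R by (intro mult_right_mono) (simp_all add: \<theta>_def)
  also have "\<dots> < \<eta>" using B R \<eta> by simp
  finally have \<theta>R: "\<theta> * B\<^sup>2 * R < \<eta>" by (simp add: mult.assoc)
  let ?f = "lyapunov \<theta> N"
  \<comment> \<open>Below level \<open>c\<close> every potential exceeds \<open>B\<close>, and
    \<open>B\<close> minus the largest correction \<open>CARD('v) * N\<close> is
    \<open>N + 1\<close>, so every queue is longer than \<open>N\<close>.\<close>
  define c where "c = exp (- \<theta> * B)"
  have neg: "generator ?f x < 0" if "?f x < c" for x
  proof (rule lyapunov_drift[where x = x and N = N, OF _ tail[of "\<lambda>u. x u ! N"] \<theta> \<theta>R[unfolded R_def] B_def])
    fix v
    have "exp (- \<theta> * potential N x v) \<le> ?f x"
      unfolding lyapunov_def by (rule member_le_sum) auto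
    also have "\<dots> < exp (- \<theta> * B)" using that by (simp only: c_def)
    finally have "exp (- \<theta> * potential N x v) < exp (- \<theta> * B)" .
    then have "B < potential N x v" using \<theta> by simp
    also have "\<dots> \<le> length (x v) + real CARD('v) * N" by (rule potential_le)
    finally show "N < length (x v)" by (simp add: B_def)
  qed
  \<comment> \<open>Where \<open>?h\<close> equals \<open>c\<close> it is maximal, so no transition
    raises it; elsewhere its increments are at most those of the Lyapunov function.\<close>
  let ?h = "\<lambda>x. min (?f x) c"
  have h_neg: "generator ?h x < 0" if "?f x < c" for x
  proof -
    have "generator ?h x \<le> generator ?f x"
      by (rule generator_mono) (use that in auto)
    then show ?thesis using neg[OF that] by (rule order.strict_trans1)
  qed
  have h_nonpos: "generator ?h x \<le> 0" for x
  proof (cases "?f x < c")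
    case False
    have "generator ?h x \<le> generator (\<lambda>_. 0) x"
      using False by (intro generator_mono) auto
    then show ?thesis by (simp add: generator_def)
  qed (use h_neg less_imp_le in blast)
  show ?thesis
  proof (rule transient_ctmc_superharmonic[where r = lam and h = ?h])
    show "0 \<le> ?h x" for x by (auto simp: lyapunov_def c_def sum_nonneg)
    show "(\<Sum>y | network_rate E lam bet D x y \<noteq> 0. network_rate E lam bet D x y * (?h y - ?h x)) \<le> 0" for x
      using h_nonpos[of x] by (simp add: generator_def)
    show "\<exists>y. (\<Sum>z | network_rate E lam bet D y z \<noteq> 0. network_rate E lam bet D y z * (?h z - ?h y)) < 0 \<and>
      (x, y) \<in> {(x, y). x \<noteq> y \<and> 0 < network_rate E lam bet D x y}\<^sup>*" for x
    proof -
      \<comment> \<open>Queues of length at least a suitable \<open>n\<close> everywhere bring the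
        Lyapunov function below \<open>c\<close>.\<close>
      have "((\<lambda>n. real CARD('v) * exp (- \<theta> * real n)) \<longlongrightarrow> 0) sequentially"
        using \<theta>(1) by real_asymp
      then have "\<forall>\<^sub>F n in sequentially. real CARD('v) * exp (- \<theta> * real n) < c"
        by (rule order_tendstoD) (simp add: c_def)
      then obtain n where n: "real CARD('v) * exp (- \<theta> * real n) < c"
        by (auto simp: eventually_sequentially)
      obtain y where y: "(x, y) \<in> {(x, y). x \<noteq> y \<and> 0 < network_rate E lam bet D x y}\<^sup>*"
        "\<And>v. n \<le> length (y v)"
        using long_queues_reachable[OF lam_pos less_imp_le[OF bet_pos], of x E D n] by blast
      have "?f y \<le> (\<Sum>w\<in>(UNIV :: 'v set). exp (- \<theta> * real n))"
        unfolding lyapunov_def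
      proof (rule sum_mono)
        fix w
        have "real n \<le> potential N y w"
          using y(2)[of w] potential_ge[of y w N] by linarith
        then show "exp (- \<theta> * potential N y w) \<le> exp (- \<theta> * real n)"
          using \<theta> by simp
      qed
      with n have "?f y < c" by simp
      from h_neg[OF this] y(1) show ?thesis by (auto simp: generator_def)
    qed
    show "0 \<le> network_rate E lam bet D x y" for x y
      using lam_pos bet_pos by (intro network_rate_nonneg) auto
    show "finite {y. network_rate E lam bet D x y \<noteq> 0}" for x
      by (rule sum_network_rate(1))
    show "lam \<le> exit_rate (network_rate E lam bet D) x" for x
      using lam_pos bet_pos by (intro exit_rate_network_ge) auto
  qed (rule lam_pos)
qed

end

theorem theorem12:
  fixes E :: "'v::finite set set"
    and g :: nat
    and lam bet :: real
    and D :: "'v \<Rightarrow> 'v pmf"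
  assumes "g > 0"
    and "simple_graph E"
    and "connected_graph E"
    and "regular_graph g E"
    and "lam > 0"
    and "bet > 0"
    and "real CARD('v) > (real g + 1) / lam"
  shows "transient_ctmc TYPE('w) (network_rate E lam bet D)"
proof -
  interpret mobile_queues E g lam bet D
    by (rule mobile_queues.intro) (fact assms)+
  show ?thesis by (rule transient)
qed

end
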